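(* Let $G$ be a finite graph (loops and multiple edges allowed) with a fixed orientation and let $\mathbb{F}$ be a field. (a) If $\mathbb{F}$ is an infinite field, then $$(t-1)^{|E(G)|}=\sum_{X\in L(\mathcal{A}_{\Pi(G)})}\varphi_G(X,t)\,\chi(\mathcal{A}_{\Pi(G)}/X,t).$$ If $\mathbb{F}$ is a finite field of $q$ elements, then $$(q-1)^{|E(G)|}=\sum_{X\in L(\mathcal{A}_{\Pi(G)})}\varphi_G(X,q)\,\chi(\mathcal{A}_{\Pi(G)}/X,q).$$ (b) If $\mathbb{F}$ is an infinite field, then $$t^{|E_{\rm cut}(G)|}(t-1)^{|E_{\rm cyc}(G)|}=\sum_{\tilde{X}\in L(\mathcal{A}_{\tilde{\Pi}(G)})}\tilde{\varphi}_G(\tilde{X},t)\,\chi(\mathcal{A}_{\tilde{\Pi}(G)}/\tilde{X},t).$$ If $\mathbb{F}$ is a finite field of $q$ elements, then $$q^{|E_{\rm cut}(G)|}(q-1)^{|E_{\rm cyc}(G)|}=\sum_{\tilde{X}\in L(\mathcal{A}_{\tilde{\Pi}(G)})}\tilde{\varphi}_G(\tilde{X},q)\,\chi(\mathcal{A}_{\tilde{\Pi}(G)}/\tilde{X},q).$$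
   Context: Graph notation. For $S\subseteq E(G)$: $S^c=E(G)\smallsetminus S$; $c(S)$ is the number of components of $(V(G),S)$; $n(S)=|S|-|V(G)|+c(S)$. $\pi(S)$ is the partition of $V(G)$ into vertex sets of components of $(V(G),S)$; $\Pi(G)=\{\pi(S):S\subseteq E(G)\}$. $E_{\rm cyc}(G)$ is the set of edges contained in at least one cycle (loops included), $E_{\rm cut}(G)=E(G)\smallsetminus E_{\rm cyc}(G)$. $\tilde\Pi(G)=\{\pi(S)\in\Pi(G):E_{\rm cut}(G)\subseteq S\}$. For $\mathfrak{p}\subseteq\Pi(G)$, $\varphi_G(\mathfrak{p},t)=\sum_{S\subseteq E(G),\,\pi(S)\in\mathfrak{p}}(-1)^{|S^c|}t^{n(S)}$. Boundary spaces. The boundary operator $\partial:\mathbb{F}^{E(G)}\to\mathbb{F}^{V(G)}$ is $\partial\boldsymbol c(v)=\sum_{e\in E^+(v)}\boldsymbol c(e)-\sum_{e\in E^-(v)}\boldsymbol c(e)$, where $E^+(v)$ (resp. $E^-(v)$) is the set of edges with head (resp. tail) $v$ (loops contribute $0$). $B(G,\mathbb{F})=\partial(\mathbb{F}^{E(G)})$. For $\pi\in\Pi(G)$, $B_\pi=\{\boldsymbol x\in\mathbb{F}^{V(G)}:\sum_{v\in U}\boldsymbol x(v)=0\text{ for every block }U\in\pi\}$, a subspace of $B(G,\mathbb{F})$. For $\boldsymbol b\in B(G,\mathbb{F})$, $\Pi_{\boldsymbol b}=\{\pi\in\Pi(G):\boldsymbol b\in B_\pi\}$ and $\tilde\Pi_{\boldsymbol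 b}=\{\pi\in\tilde\Pi(G):\boldsymbol b\in B_\pi\}$. Arrangements. For a hyperplane arrangement $\mathcal{A}$ in a vector space $V$ over $\mathbb{F}$: $\chi(\mathcal{A},t)=\sum_{\mathcal{B}\subseteq\mathcal{A},\,\bigcap_{H\in\mathcal{B}}H\neq\emptyset}(-1)^{|\mathcal{B}|}t^{\dim\bigcap_{H\in\mathcal{B}}H}$; $L(\mathcal{A})$ is the set of all nonempty intersections of members of $\mathcal{A}$ (including $V$ as the empty intersection), ordered by reverse inclusion, whose elements are called flats; $M(\mathcal{A})=V\smallsetminus\bigcup_{H\in\mathcal{A}}H$. For a flat $X$, $\mathcal{A}/X=\{H\cap X\neq\emptyset:H\in\mathcal{A},\,X\nsubseteq H\}$ is an arrangement in the ambient space $X$. Boundary arrangements (hyperplane arrangements in $B(G,\mathbb{F})$; $|\pi|$ is the number of blocks): $\mathcal{A}_{\Pi(G)}=\{B_\pi:\pi\in\Pi(G),|\pi|=|\pi(E(G))|+1\}$ and $\mathcal{A}_{\tilde\Pi(G)}=\{B_\pi:\pi\in\tilde\Pi(G),|\pi|=|\pi(E(G))|+1\}$. For any $X\in L(\mathcal{A}_{\Pi(G)})$, the polynomials $\varphi_G(\Pi_{\boldsymbol b},t)$ are the same polynomial for all $\boldsymbol b\in M(\mathcal{A}_{\Pi(G)}/X)$, denoted $\varphi_G(X,t)$; for any $\tilde X\in L(\mathcal{A}_{\tilde\Pi(G)})$, the polynomials $\varphi_G(\tilde\Pi_{\boldsymbol b},t)$ are the same polynomial for all $\boldsymbol b\in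 M(\mathcal{A}_{\tilde\Pi(G)}/\tilde X)$, denoted $\tilde\varphi_G(\tilde X,t)$. *)

theory Defs
  imports
    "Graph_Theory.Graph_Theory"
    "HOL-Computational_Algebra.Polynomial"
    "HOL-Library.Function_Algebras"
begin

text \<open>
  A graph together with a fixed orientation is a digraph in the sense of the Graph-Theory library
  (loops and parallel arcs allowed); its arcs are the oriented edges. Connectivity and cycles refer
  to the underlying undirected multigraph.
\<close>

section \<open>Graphs\<close>

definition spanning_sub :: "('v, 'e) pre_digraph \<Rightarrow> 'e set \<Rightarrow> ('v, 'e) pre_digraph" where
  "spanning_sub G S = G\<lparr>arcs := S\<rparr>"

text \<open>The partition \<open>\<pi>(S)\<close>: vertex sets of the components of \<open>(V(G), S)\<close>.\<close>

definition comp_partition :: "('v, 'e) pre_digraph \<Rightarrow> 'e set \<Rightarrow> 'v set set" where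
  "comp_partition G S =
     verts G // {(u, v). u \<rightarrow>\<^sup>*\<^bsub>with_proj (mk_symmetric (spanning_sub G S))\<^esub> v}"

definition num_comps :: "('v, 'e) pre_digraph \<Rightarrow> 'e set \<Rightarrow> nat" where
  "num_comps G S = card (comp_partition G S)"

text \<open>The subtraction does not truncate, since \<open>|S| + c(S) \<ge> |V(G)|\<close>.\<close>

definition nullity :: "('v, 'e) pre_digraph \<Rightarrow> 'e set \<Rightarrow> nat" where
  "nullity G S = card S + num_comps G S - card (verts G)"

definition bond_partitions :: "('v, 'e) pre_digraph \<Rightarrow> 'v set set set" where
  "bond_partitions G = {comp_partition G S | S. S \<subseteq> arcs G}"

definition joins :: "('v, 'e) pre_digraph \<Rightarrow> 'e \<Rightarrow> 'v \<Rightarrow> 'v \<Rightarrow> bool" where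
  "joins G e u v \<longleftrightarrow> (tail G e = u \<and> head G e = v) \<or> (tail G e = v \<and> head G e = u)"

text \<open>
  The edge sequence \<open>es\<close> runs cyclically through the distinct vertices \<open>vs\<close>. The library's
  \<open>cycle\<close> is not used because it respects orientation. Length 1 gives loops; for length 2
  distinctness of \<open>es\<close> forces two parallel edges.
\<close>

definition undirected_cycle :: "('v, 'e) pre_digraph \<Rightarrow> 'v list \<Rightarrow> 'e list \<Rightarrow> bool" where
  "undirected_cycle G vs es \<longleftrightarrow>
     es \<noteq> [] \<and> length vs = length es \<and> distinct vs \<and> distinct es \<and>
     set vs \<subseteq> verts G \<and> set es \<subseteq> arcs G \<and>
     (\<forall>i < length es. joins G (es ! i) (vs ! i) (vs ! (Suc i mod length es)))"

definition cyc_edges :: "('v, 'e) pre_digraph \<Rightarrow> 'e set" where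
  "cyc_edges G = {e \<in> arcs G. \<exists>vs es. undirected_cycle G vs es \<and> e \<in> set es}"

definition cut_edges :: "('v, 'e) pre_digraph \<Rightarrow> 'e set" where
  "cut_edges G = arcs G - cyc_edges G"

definition bond_partitions_cut :: "('v, 'e) pre_digraph \<Rightarrow> 'v set set set" where
  "bond_partitions_cut G = {comp_partition G S | S. S \<subseteq> arcs G \<and> cut_edges G \<subseteq> S}"

definition phi :: "('v, 'e) pre_digraph \<Rightarrow> 'v set set set \<Rightarrow> int poly" where
  "phi G P = (\<Sum>S | S \<subseteq> arcs G \<and> comp_partition G S \<in> P.
                monom ((-1) ^ card (arcs G - S)) (nullity G S))"

section \<open>Boundary spaces\<close>

text \<open>The space \<open>\<F>\<^sup>A\<close>, realised as the functions vanishing outside \<open>A\<close>.\<close>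

definition coord_space :: "'a set \<Rightarrow> ('a \<Rightarrow> 'f::field) set" where
  "coord_space A = {x. \<forall>a. a \<notin> A \<longrightarrow> x a = 0}"

definition boundary :: "('v, 'e) pre_digraph \<Rightarrow> ('e \<Rightarrow> 'f::field) \<Rightarrow> 'v \<Rightarrow> 'f" where
  "boundary G c v = (\<Sum>e \<in> in_arcs G v. c e) - (\<Sum>e \<in> out_arcs G v. c e)"

definition boundary_space :: "('v, 'e) pre_digraph \<Rightarrow> ('v \<Rightarrow> 'f::field) set" where
  "boundary_space G = boundary G ` coord_space (arcs G)"

definition block_space :: "('v, 'e) pre_digraph \<Rightarrow> 'v set set \<Rightarrow> ('v \<Rightarrow> 'f::field) set" where
  "block_space G p = {x \<in> coord_space (verts G). \<forall>U \<in> p. (\<Sum>v\<in>U. x v) = 0}"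

text \<open>
  For \<open>P\<close> the full set of partitions this is \<open>\<Pi>\<^sub>b\<close>, for \<open>P = bond_partitions_cut G\<close> it is its
  tilde version.
\<close>

definition partitions_at ::
  "('v, 'e) pre_digraph \<Rightarrow> 'v set set set \<Rightarrow> ('v \<Rightarrow> 'f::field) \<Rightarrow> 'v set set set" where
  "partitions_at G P b = {p \<in> P. b \<in> block_space G p}"

section \<open>Hyperplane arrangements\<close>

text \<open>
  An arrangement is given by its ambient space \<open>W\<close>, a subspace of a space of functions,
  and its set \<open>\<A>\<close> of hyperplanes of \<open>W\<close>.
\<close>

interpretation fun_space: vector_space "\<lambda>(c::'f::field) (x::'a \<Rightarrow> 'f) a. c * x a"
  by unfold_locales (auto simp: fun_eq_iff algebra_simps)

text \<open>Dimension of an affine subspace, that is, of its space of directions.\<close>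

definition flat_dim :: "('a \<Rightarrow> 'f::field) set \<Rightarrow> nat" where
  "flat_dim X = fun_space.dim {x - y | x y. x \<in> X \<and> y \<in> X}"

definition char_poly :: "('a \<Rightarrow> 'f::field) set \<Rightarrow> ('a \<Rightarrow> 'f) set set \<Rightarrow> int poly" where
  "char_poly W \<A> = (\<Sum>\<B> | \<B> \<subseteq> \<A> \<and> W \<inter> \<Inter>\<B> \<noteq> {}.
                       monom ((-1) ^ card \<B>) (flat_dim (W \<inter> \<Inter>\<B>)))"

definition flats :: "('a \<Rightarrow> 'f::field) set \<Rightarrow> ('a \<Rightarrow> 'f) set set \<Rightarrow> ('a \<Rightarrow> 'f) set set" where
  "flats W \<A> = {W \<inter> \<Inter>\<B> | \<B>. \<B> \<subseteq> \<A> \<and> W \<inter> \<Inter>\<B> \<noteq> {}}"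

definition arr_complement :: "('a \<Rightarrow> 'f::field) set \<Rightarrow> ('a \<Rightarrow> 'f) set set \<Rightarrow> ('a \<Rightarrow> 'f) set" where
  "arr_complement W \<A> = W - \<Union>\<A>"

text \<open>The arrangement \<open>\<A>/X\<close>, whose ambient space is \<open>X\<close>.\<close>

definition restrict_arr :: "('a \<Rightarrow> 'f::field) set set \<Rightarrow> ('a \<Rightarrow> 'f) set \<Rightarrow> ('a \<Rightarrow> 'f) set set" where
  "restrict_arr \<A> X = {H \<inter> X | H. H \<in> \<A> \<and> \<not> X \<subseteq> H \<and> H \<inter> X \<noteq> {}}"

section \<open>Boundary arrangements\<close>

text \<open>
  The parameter \<open>P\<close> is \<open>bond_partitions G\<close> or \<open>bond_partitions_cut G\<close>; the ambient space is
  \<open>boundary_space G\<close>.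
\<close>

definition boundary_arr ::
  "('v, 'e) pre_digraph \<Rightarrow> 'v set set set \<Rightarrow> ('v \<Rightarrow> 'f::field) set set" where
  "boundary_arr G P =
     {block_space G p | p. p \<in> P \<and> card p = card (comp_partition G (arcs G)) + 1}"

text \<open>
  The common value of \<open>phi G (partitions_at G P b)\<close> over all \<open>b\<close> in the complement of \<open>\<A>/X\<close>.
  Over a finite field this complement can be empty, and the value is then an unspecified
  polynomial; in that case the characteristic polynomial of \<open>\<A>/X\<close> vanishes at the field size.
\<close>

definition phi_flat ::
  "('v, 'e) pre_digraph \<Rightarrow> 'v set set set \<Rightarrow> ('v \<Rightarrow> 'f::field) set \<Rightarrow> int poly" where
  "phi_flat G P X = (THE f. \<forall>b \<in> arr_complement X (restrict_arr (boundary_arr G P) X).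
                              phi G (partitions_at G P b) = f)"

end

theory Submission
  imports Defs "HOL-Library.Disjoint_Sets"
begin

text \<open>
  Both parts are one polynomial identity, evaluated by exchanging two sums. Fix a set \<open>C\<close> of arcs and
  let \<open>P\<close> be the set of partitions \<open>\<pi>(S)\<close> with \<open>C \<subseteq> S\<close>; part (a) is \<open>C = \<emptyset>\<close>, part (b) is the set of
  cut edges. For \<open>\<pi> \<in> P\<close> and \<open>b\<close> in the complement of \<open>\<A>/X\<close> one has \<open>b \<in> B\<^sub>\<pi>\<close> iff \<open>X \<subseteq> B\<^sub>\<pi>\<close>,
  because \<open>B\<^sub>\<pi>\<close> is itself a flat
  (\<open>block_space_flat\<close>). Hence \<open>\<phi>(X)\<close> is the sum over all \<open>S\<close> with \<open>\<pi>(S) \<in> P\<close> and \<open>X \<subseteq> B\<^bsub>\<pi>(S)\<^esub>\<close>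
  of \<open>(-1)\<^bsup>|S\<^sup>c|\<^esup> t\<^bsup>n(S)\<^esup>\<close>. Exchanging the sums over \<open>X\<close> and \<open>S\<close> leaves, for each \<open>S\<close>, the sum of
  \<open>\<chi>(\<A>/X, t)\<close> over the flats \<open>X \<subseteq> B\<^bsub>\<pi>(S)\<^esub>\<close>. This inner sum is \<open>t\<close> to the power
  \<open>dim B\<^bsub>\<pi>(S)\<^esub> = |V| - c(S)\<close> by Moebius inversion on the poset of flats (\<open>sum_char_poly_restrict\<close>), and
  \<open>n(S) + |V| - c(S) = |S|\<close>. What remains is the sum of \<open>(-1)\<^bsup>|S\<^sup>c|\<^esup> t\<^bsup>|S|\<^esup>\<close> over all \<open>S\<close> with \<open>\<pi>(S) \<in> P\<close>.
  These are exactly the \<open>S\<close> containing \<open>C\<close>: for cut edges, an arc outside \<open>S\<close> whose ends lie in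
  one component of \<open>S\<close> closes a cycle. The binomial theorem finishes the computation.

  This argument is valid over every field. The size of the field matters only for \<open>\<phi>(X)\<close> to be
  well defined. Over an infinite field the complement of \<open>\<A>/X\<close> is nonempty, since a vector space
  is not a finite union of proper subspaces (\<open>subspace_not_finite_Union\<close>). Over a field of \<open>q\<close>
  elements the complement has \<open>\<chi>(\<A>/X, q)\<close> points (\<open>char_poly_eq_card_complement\<close>), so that flats
  with an empty complement contribute \<open>0\<close> at \<open>t = q\<close>, whatever polynomial \<open>\<phi>(X)\<close> denotes.

  That \<open>B\<^sub>\<pi>\<close> is a flat is the graph-theoretic core, \<open>block_space_bond_intersection\<close>: a boundary
  vector whose block sums vanish for all coarsenings of \<open>\<pi>(S)\<close> having one block more than
  \<open>\<pi>(E(G))\<close> has vanishing block sums for \<open>\<pi>(S)\<close> itself.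
\<close>

section \<open>Alternating sums over subsets\<close>

lemma binomial_sum_Pow:
  fixes a b :: "'r::comm_ring_1"
  assumes "finite A"
  shows "(\<Sum>S\<in>Pow A. a ^ card S * b ^ card (A - S)) = (a + b) ^ card A"
  using prod_add[OF assms, of "\<lambda>_. a" "\<lambda>_. b"] by simp

text \<open>
  The alternating sum over the subsets of those \<open>H\<close> that are incident with \<open>z\<close> is
  \<open>(1 - 1)\<close> to the power of their number, so it keeps exactly the \<open>z\<close> incident with no \<open>H\<close>. It is used
  with flats as the points \<open>z\<close>, to identify \<open>\<chi>(\<A>/X)\<close> as a Moebius inverse, and with the vectors of
  a finite space, to count the complement of an arrangement.
\<close>

lemma inclusion_exclusion_weighted:
  fixes w :: "'b \<Rightarrow> 'r::comm_ring_1"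
  assumes R: "finite R" and O: "finite \<Omega>"
  shows "(\<Sum>\<B>\<in>Pow R. (-1) ^ card \<B> * (\<Sum>z | z \<in> \<Omega> \<and> (\<forall>H\<in>\<B>. Q z H). w z))
       = (\<Sum>z | z \<in> \<Omega> \<and> (\<forall>H\<in>R. \<not> Q z H). w z)"
proof -
  have inner: "(\<Sum>\<B> | \<B> \<in> Pow R \<and> (\<forall>H\<in>\<B>. Q z H). (-1) ^ card \<B> * w z)
      = (if \<forall>H\<in>R. \<not> Q z H then w z else 0)" for z
  proof -
    have "{\<B>. \<B> \<in> Pow R \<and> (\<forall>H\<in>\<B>. Q z H)} = Pow {H\<in>R. Q z H}" by auto
    moreover have "(\<Sum>\<B>\<in>Pow {H\<in>R. Q z H}. (-1) ^ card \<B>) = (0::'r) ^ card {H\<in>R. Q z H}"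
      using binomial_sum_Pow[of "{H\<in>R. Q z H}" "-1::'r" 1] R by simp
    moreover have "card {H\<in>R. Q z H} = 0 \<longleftrightarrow> (\<forall>H\<in>R. \<not> Q z H)"
      using R by auto
    ultimately show ?thesis
      by (auto simp: sum_distrib_right[symmetric] power_0_left)
  qed
  have "(\<Sum>\<B>\<in>Pow R. (-1) ^ card \<B> * (\<Sum>z | z \<in> \<Omega> \<and> (\<forall>H\<in>\<B>. Q z H). w z))
      = (\<Sum>z\<in>\<Omega>. \<Sum>\<B> | \<B> \<in> Pow R \<and> (\<forall>H\<in>\<B>. Q z H). (-1) ^ card \<B> * w z)"
    using R O by (simp add: sum_distrib_left sum.swap_restrict)
  also have "\<dots> = (\<Sum>z | z \<in> \<Omega> \<and> (\<forall>H\<in>R. \<not> Q z H). w z)"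
    unfolding inner using O by (simp add: sum.inter_filter)
  finally show ?thesis .
qed

text \<open>
  Inclusion is unitriangular on a finite family, so the values of \<open>g\<close> can be solved for one set at
  a time, a maximal set last.
\<close>

lemma moebius_inversion_exists:
  fixes f :: "'a set \<Rightarrow> 'r::ab_group_add"
  assumes "finite L"
  shows "\<exists>g. \<forall>Y\<in>L. (\<Sum>Z | Z \<in> L \<and> Z \<subseteq> Y. g Z) = f Y"
  using assms
proof (induction "card L" arbitrary: L)
  case 0
  then show ?case by simp
next
  case (Suc n)
  then have "L \<noteq> {}" by auto
  then obtain X where X: "X \<in> L" "\<forall>Y\<in>L. X \<subseteq> Y \<longrightarrow> X = Y"
    using finite_has_maximal[OF Suc.prems] by metis
  obtain g where g: "\<forall>Y\<in>L - {X}. (\<Sum>Z | Z \<in> L - {X} \<and> Z \<subseteq> Y. g Z) = f Y"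
  proof -
    have "n = card (L - {X})" "finite (L - {X})" using Suc.hyps(2) Suc.prems X(1) by auto
    then show ?thesis using Suc.hyps(1) that by blast
  qed
  define h where "h = g(X := f X - (\<Sum>Z | Z \<in> L - {X} \<and> Z \<subseteq> X. g Z))"
  have hg: "(\<Sum>Z | Z \<in> L - {X} \<and> Z \<subseteq> Y. h Z) = (\<Sum>Z | Z \<in> L - {X} \<and> Z \<subseteq> Y. g Z)" for Y
    by (rule sum.cong) (auto simp: h_def)
  have "(\<Sum>Z | Z \<in> L \<and> Z \<subseteq> Y. h Z) = f Y" if Y: "Y \<in> L" for Y
  proof (cases "Y = X")
    case True
    have "{Z. Z \<in> L \<and> Z \<subseteq> X} = insert X {Z. Z \<in> L - {X} \<and> Z \<subseteq> X}" using X by auto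
    moreover have "finite {Z. Z \<in> L - {X} \<and> Z \<subseteq> X}" using Suc.prems by simp
    ultimately have "(\<Sum>Z | Z \<in> L \<and> Z \<subseteq> X. h Z) = h X + (\<Sum>Z | Z \<in> L - {X} \<and> Z \<subseteq> X. h Z)"
      by (simp only: sum.insert) auto
    then show ?thesis unfolding True hg by (simp add: h_def)
  next
    case False
    then have "{Z. Z \<in> L \<and> Z \<subseteq> Y} = {Z. Z \<in> L - {X} \<and> Z \<subseteq> Y}" using X Y by auto
    then show ?thesis using hg[of Y] g Y False by simp
  qed
  then show ?case by blast
qed

section \<open>Linear arrangements\<close>

lemma coord_space_subspace: "fun_space.subspace (coord_space A :: ('a \<Rightarrow> 'f::field) set)"
  by (auto simp: fun_space.subspace_def coord_space_def)

lemma flat_dim_subspace: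
  assumes "fun_space.subspace X"
  shows "flat_dim X = fun_space.dim X"
proof -
  have "{x - y | x y. x \<in> X \<and> y \<in> X} = X"
    using fun_space.subspace_diff[OF assms] fun_space.subspace_0[OF assms]
    by (force intro: exI[of _ 0])
  then show ?thesis unfolding flat_dim_def by simp
qed

lemma subspace_Int_Inter:
  assumes "fun_space.subspace W" "\<forall>H\<in>\<B>. fun_space.subspace H"
  shows "fun_space.subspace (W \<inter> \<Inter>\<B>)"
  using fun_space.subspace_Inter[of "insert W \<B>"] assms by auto

text \<open>
  An intersection of members of \<open>\<A>/X\<close> is cut out of \<open>W\<close> by the hyperplanes defining \<open>X\<close> together
  with all hyperplanes whose traces on \<open>X\<close> were chosen.
\<close>

lemma flats_closed:
  assumes X: "X \<in> flats W \<A>" and "\<B> \<subseteq> restrict_arr \<A> X" and ne: "X \<inter> \<Inter>\<B> \<noteq> {}"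
  shows "X \<inter> \<Inter>\<B> \<in> flats W \<A>"
proof -
  obtain \<C> where C: "\<C> \<subseteq> \<A>" "X = W \<inter> \<Inter>\<C>" using X by (auto simp: flats_def)
  define \<D> where "\<D> = {H\<in>\<A>. H \<inter> X \<in> \<B>}"
  have "X \<inter> \<Inter>\<B> = W \<inter> \<Inter>(\<C> \<union> \<D>)"
  proof
    show "X \<inter> \<Inter>\<B> \<subseteq> W \<inter> \<Inter>(\<C> \<union> \<D>)" unfolding C(2) \<D>_def by blast
    show "W \<inter> \<Inter>(\<C> \<union> \<D>) \<subseteq> X \<inter> \<Inter>\<B>"
    proof (intro subsetI IntI InterI)
      fix x K assume x: "x \<in> W \<inter> \<Inter>(\<C> \<union> \<D>)" and K: "K \<in> \<B>"
      then obtain H where "H \<in> \<A>" "K = H \<inter> X" using assms(2) by (auto simp: restrict_arr_def)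
      with x K show "x \<in> K" unfolding \<D>_def C(2) by blast
    qed (auto simp: C(2))
  qed
  moreover have "\<C> \<union> \<D> \<subseteq> \<A>" using C(1) by (auto simp: \<D>_def)
  ultimately have "\<exists>\<B>'. X \<inter> \<Inter>\<B> = W \<inter> \<Inter>\<B>' \<and> \<B>' \<subseteq> \<A> \<and> W \<inter> \<Inter>\<B>' \<noteq> {}"
    using ne by metis
  then show ?thesis unfolding flats_def by simp
qed

text \<open>
  A hyperplane containing \<open>Z\<close> contains \<open>b\<close>; if it did not contain \<open>X\<close>, its trace on \<open>X\<close> would be
  a member of \<open>\<A>/X\<close> through \<open>b\<close>. So \<open>X\<close> is the smallest flat through \<open>b\<close>.
\<close>

lemma flat_avoiding_restriction:
  assumes X: "X \<in> flats W \<A>" and Z: "Z \<in> flats W \<A>"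
    and b: "b \<in> arr_complement X (restrict_arr \<A> X)" "b \<in> Z"
  shows "X \<subseteq> Z"
proof -
  obtain \<C> where C: "\<C> \<subseteq> \<A>" "Z = W \<inter> \<Inter>\<C>" using Z by (auto simp: flats_def)
  have "X \<subseteq> H" if "H \<in> \<C>" for H
  proof (rule ccontr)
    assume "\<not> X \<subseteq> H"
    moreover have "b \<in> H \<inter> X" "H \<in> \<A>"
      using b C that by (auto simp: arr_complement_def)
    ultimately have "H \<inter> X \<in> restrict_arr \<A> X" unfolding restrict_arr_def by blast
    then show False using b(1) \<open>b \<in> H \<inter> X\<close> by (auto simp: arr_complement_def)
  qed
  moreover have "X \<subseteq> W" using X by (auto simp: flats_def)
  ultimately show ?thesis using C by auto
qed

lemma finite_flats:
  assumes "finite \<A>" shows "finite (flats W \<A>)"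
proof -
  have "flats W \<A> \<subseteq> (\<lambda>\<B>. W \<inter> \<Inter>\<B>) ` Pow \<A>" by (auto simp: flats_def)
  then show ?thesis using assms by (meson finite_Pow_iff finite_imageI finite_subset)
qed

lemma finite_restrict_arr: "finite \<A> \<Longrightarrow> finite (restrict_arr \<A> X)"
  by (rule finite_subset[of _ "(\<lambda>H. H \<inter> X) ` \<A>"]) (auto simp: restrict_arr_def)

lemma subspace_flat:
  assumes "fun_space.subspace W" "\<forall>H\<in>\<A>. fun_space.subspace H" "X \<in> flats W \<A>"
  shows "fun_space.subspace X"
proof -
  obtain \<B> where "\<B> \<subseteq> \<A>" "X = W \<inter> \<Inter>\<B>" using assms(3) by (auto simp: flats_def)
  then show ?thesis using assms(1,2) subspace_Int_Inter[of W \<B>] by blast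
qed

lemma subspace_restrict_arr:
  assumes "\<forall>H\<in>\<A>. fun_space.subspace H" "fun_space.subspace X" "K \<in> restrict_arr \<A> X"
  shows "fun_space.subspace K"
  using assms fun_space.subspace_inter by (fastforce simp: restrict_arr_def)

lemma char_poly_linear:
  assumes X: "fun_space.subspace X" and R: "\<forall>H\<in>R. fun_space.subspace H"
  shows "char_poly X R = (\<Sum>\<B>\<in>Pow R. (-1) ^ card \<B> * monom 1 (flat_dim (X \<inter> \<Inter>\<B>)))"
proof -
  have "{\<B>. \<B> \<subseteq> R \<and> X \<inter> \<Inter>\<B> \<noteq> {}} = Pow R"
    using X R fun_space.subspace_0 by blast
  moreover have "monom ((-1) ^ k) n = (-1) ^ k * (monom 1 n :: int poly)" for k n :: nat
    by (cases "even k") (auto simp: minus_monom)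
  ultimately show ?thesis unfolding char_poly_def by simp
qed

text \<open>
  The polynomials \<open>\<chi>(\<A>/X, t)\<close> are the Moebius inverse of \<open>Y \<mapsto> t\<^bsup>dim Y\<^esup>\<close>. Substitute
  the sum of the \<open>g Z\<close> over \<open>Z \<subseteq> Y\<close> for each \<open>t\<^bsup>dim Y\<^esup>\<close> in the definition of \<open>\<chi>(\<A>/X, t)\<close>:
  inclusion-exclusion keeps \<open>g Z\<close> only for the flats \<open>Z \<subseteq> X\<close> that lie in no member of \<open>\<A>/X\<close>,
  and the only such flat is \<open>X\<close>. Thus each flat plays the part of one generic vector, and the argument
  works over every field.
\<close>

lemma char_poly_restrict_eq_moebius:
  assumes fin: "finite \<A>" and W: "fun_space.subspace W"
    and A: "\<forall>H\<in>\<A>. fun_space.subspace H"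
    and g: "\<forall>Y\<in>flats W \<A>. (\<Sum>Z | Z \<in> flats W \<A> \<and> Z \<subseteq> Y. g Z) = monom 1 (flat_dim Y)"
    and X: "X \<in> flats W \<A>"
  shows "char_poly X (restrict_arr \<A> X) = g X"
proof -
  let ?R = "restrict_arr \<A> X" and ?L = "flats W \<A>"
  have subX: "fun_space.subspace X" using subspace_flat[OF W A X] .
  have subR: "\<forall>H\<in>?R. fun_space.subspace H"
    using subspace_restrict_arr[OF A subX] by blast
  have flat: "X \<inter> \<Inter>\<B> \<in> ?L" if "\<B> \<subseteq> ?R" for \<B>
  proof -
    have "0 \<in> X \<inter> \<Inter>\<B>" using that subX subR fun_space.subspace_0 by blast
    then show ?thesis using flats_closed[OF X that] by blast
  qed
  have "char_poly X ?R = (\<Sum>\<B>\<in>Pow ?R. (-1) ^ card \<B> *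
      (\<Sum>Z | Z \<in> {Z\<in>?L. Z \<subseteq> X} \<and> (\<forall>H\<in>\<B>. Z \<subseteq> H). g Z))"
    unfolding char_poly_linear[OF subX subR]
  proof (rule sum.cong[OF refl], rule arg_cong[where f = "\<lambda>p. _ * p"])
    fix \<B> assume "\<B> \<in> Pow ?R"
    then have "monom 1 (flat_dim (X \<inter> \<Inter>\<B>)) = (\<Sum>Z | Z \<in> ?L \<and> Z \<subseteq> X \<inter> \<Inter>\<B>. g Z)"
      using bspec[OF g flat[of \<B>]] by simp
    also have "\<dots> = (\<Sum>Z | Z \<in> {Z\<in>?L. Z \<subseteq> X} \<and> (\<forall>H\<in>\<B>. Z \<subseteq> H). g Z)"
      by (rule sum.cong) auto
    finally show "monom 1 (flat_dim (X \<inter> \<Inter>\<B>)) = \<dots>" .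
  qed
  also have "\<dots> = (\<Sum>Z | Z \<in> {Z\<in>?L. Z \<subseteq> X} \<and> (\<forall>H\<in>?R. \<not> Z \<subseteq> H). g Z)"
    using fin finite_flats[OF fin] finite_restrict_arr[OF fin]
    by (intro inclusion_exclusion_weighted) auto
  also have "{Z. Z \<in> {Z\<in>?L. Z \<subseteq> X} \<and> (\<forall>H\<in>?R. \<not> Z \<subseteq> H)} = {X}"
  proof -
    have "Z = X" if Z: "Z \<in> ?L" "Z \<subseteq> X" "\<forall>H\<in>?R. \<not> Z \<subseteq> H" for Z
    proof (rule ccontr)
      assume "Z \<noteq> X"
      obtain \<C> where C: "\<C> \<subseteq> \<A>" "Z = W \<inter> \<Inter>\<C>" using Z(1) by (auto simp: flats_def)
      have "X \<subseteq> W" using X by (auto simp: flats_def)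
      then obtain H where H: "H \<in> \<C>" "\<not> X \<subseteq> H" using C(2) Z(2) \<open>Z \<noteq> X\<close> by auto
      have "0 \<in> H \<inter> X" using H C(1) A subX fun_space.subspace_0 by blast
      then have "H \<inter> X \<in> ?R" using H C(1) unfolding restrict_arr_def by blast
      moreover have "Z \<subseteq> H \<inter> X" using C(2) H(1) Z(2) by auto
      ultimately show False using Z(3) by blast
    qed
    moreover have "\<not> X \<subseteq> H" if "H \<in> ?R" for H using that by (auto simp: restrict_arr_def)
    ultimately show ?thesis using X by auto
  qed
  finally show ?thesis by simp
qed

lemma sum_char_poly_restrict:
  assumes fin: "finite \<A>" and W: "fun_space.subspace W"
    and A: "\<forall>H\<in>\<A>. fun_space.subspace H" and U: "U \<in> flats W \<A>"
  shows "(\<Sum>X | X \<in> flats W \<A> \<and> X \<subseteq> U. char_poly X (restrict_arr \<A> X)) = monom 1 (flat_dim U)"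
proof -
  obtain g :: "_ \<Rightarrow> int poly"
    where g: "\<forall>Y\<in>flats W \<A>. (\<Sum>Z | Z \<in> flats W \<A> \<and> Z \<subseteq> Y. g Z) = monom 1 (flat_dim Y)"
    using moebius_inversion_exists[OF finite_flats[OF fin], of W "\<lambda>Y. monom 1 (flat_dim Y)"] by blast
  show ?thesis
  proof -
    have "(\<Sum>X | X \<in> flats W \<A> \<and> X \<subseteq> U. char_poly X (restrict_arr \<A> X))
        = (\<Sum>X | X \<in> flats W \<A> \<and> X \<subseteq> U. g X)"
      by (rule sum.cong) (simp_all add: char_poly_restrict_eq_moebius[OF fin W A g])
    then show ?thesis using bspec[OF g U] by simp
  qed
qed

text \<open>
  Adjoining a vector outside the span multiplies the number of vectors by the size of the field.
\<close>

lemma card_span_independent: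
  fixes B :: "('a \<Rightarrow> 'f::field) set"
  assumes "finite (UNIV :: 'f set)" "finite B" "fun_space.independent B"
  shows "card (fun_space.span B) = card (UNIV :: 'f set) ^ card B"
  using assms(2,3)
proof (induction B)
  case empty
  then show ?case by simp
next
  case (insert b B)
  let ?f = "\<lambda>(c::'f, x). (\<lambda>a. c * b a) + x"
  have ind: "b \<notin> fun_space.span B" "fun_space.independent B"
    using insert.prems insert.hyps by (auto simp: fun_space.independent_insert)
  have inj: "inj_on ?f (UNIV \<times> fun_space.span B)"
  proof (rule inj_onI, clarify, rule ccontr)
    fix c d :: 'f and x y
    assume x: "x \<in> fun_space.span B" "y \<in> fun_space.span B"
      and eq: "(\<lambda>a. c * b a) + x = (\<lambda>a. d * b a) + y" and ne: "\<not> (c = d \<and> x = y)"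
    have *: "c * b a + x a = d * b a + y a" for a using fun_cong[OF eq, of a] by simp
    show False
    proof (cases "c = d")
      case True then show False using * ne by auto
    next
      case False
      have "b a = inverse (c - d) * (y - x) a" for a
      proof -
        have "(c - d) * b a = (y - x) a" using *[of a] by (simp add: algebra_simps)
        then have "inverse (c - d) * (y - x) a = inverse (c - d) * ((c - d) * b a)" by simp
        also have "\<dots> = b a" using False by simp
        finally show ?thesis by simp
      qed
      then have "b = (\<lambda>a. inverse (c - d) * (y - x) a)" by (rule ext)
      moreover have "(\<lambda>a. inverse (c - d) * (y - x) a) \<in> fun_space.span B"
        using x by (intro fun_space.span_scale fun_space.span_diff)
      ultimately show False using ind by simp
    qed
  qed
  have "?f ` (UNIV \<times> fun_space.span B) = fun_space.span (insert b B)"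
  proof -
    have "v \<in> ?f ` (UNIV \<times> fun_space.span B)" if "v - (\<lambda>a. k * b a) \<in> fun_space.span B" for v k
    proof (rule image_eqI)
      show "v = ?f (k, v - (\<lambda>a. k * b a))" by simp
      show "(k, v - (\<lambda>a. k * b a)) \<in> UNIV \<times> fun_space.span B" using that by simp
    qed
    then have "fun_space.span (insert b B) \<subseteq> ?f ` (UNIV \<times> fun_space.span B)"
      by (auto simp only: fun_space.span_insert subset_iff mem_Collect_eq)
    moreover have "?f (c, x) \<in> fun_space.span (insert b B)" if "x \<in> fun_space.span B" for c x
    proof -
      have "x \<in> fun_space.span (insert b B)" using that fun_space.span_mono[of B "insert b B"] by blast
      moreover have "(\<lambda>a. c * b a) \<in> fun_space.span (insert b B)"
        by (intro fun_space.span_scale fun_space.span_base) simp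
      ultimately show ?thesis unfolding split by (rule fun_space.span_add[rotated])
    qed
    then have "?f ` (UNIV \<times> fun_space.span B) \<subseteq> fun_space.span (insert b B)" by auto
    ultimately show ?thesis by (intro subset_antisym)
  qed
  then have "card (fun_space.span (insert b B)) = card ((UNIV :: 'f set) \<times> fun_space.span B)"
    using card_image[OF inj] by simp
  then show ?case using insert ind by (simp add: card_cartesian_product)
qed

lemma card_subspace:
  fixes X :: "('a \<Rightarrow> 'f::field) set"
  assumes "finite (UNIV :: 'f set)" "finite X" "fun_space.subspace X"
  shows "card X = card (UNIV :: 'f set) ^ fun_space.dim X"
proof -
  obtain B where B: "B \<subseteq> X" "fun_space.independent B" "X \<subseteq> fun_space.span B" "card B = fun_space.dim X"
    using fun_space.basis_exists by blast
  then have "fun_space.span B = X" using assms(3) fun_space.span_subspace by blast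
  then show ?thesis
    using card_span_independent[OF assms(1) _ B(2)] B assms(2) finite_subset by metis
qed

lemma char_poly_eq_card_complement:
  fixes X :: "('a \<Rightarrow> 'f::field) set"
  assumes f: "finite (UNIV :: 'f set)" and finX: "finite X" and X: "fun_space.subspace X"
    and R: "\<forall>H\<in>R. fun_space.subspace H" and finR: "finite R"
  shows "poly (char_poly X R) (int (card (UNIV :: 'f set))) = int (card (arr_complement X R))"
proof -
  let ?q = "int (card (UNIV :: 'f set))"
  have "poly (char_poly X R) ?q = (\<Sum>\<B>\<in>Pow R. (-1) ^ card \<B> * ?q ^ flat_dim (X \<inter> \<Inter>\<B>))"
    unfolding char_poly_linear[OF X R] by (simp add: poly_sum poly_monom)
  also have "\<dots> = (\<Sum>\<B>\<in>Pow R. (-1) ^ card \<B> * (\<Sum>z | z \<in> X \<and> (\<forall>H\<in>\<B>. z \<in> H). 1))"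
  proof (rule sum.cong[OF refl], rule arg_cong[where f = "\<lambda>p. _ * p"])
    fix \<B> assume B: "\<B> \<in> Pow R"
    have s: "fun_space.subspace (X \<inter> \<Inter>\<B>)" using B R X by (intro subspace_Int_Inter) auto
    have "?q ^ flat_dim (X \<inter> \<Inter>\<B>) = int (card (X \<inter> \<Inter>\<B>))"
      using card_subspace[OF f _ s] finX unfolding flat_dim_subspace[OF s] by simp
    also have "card (X \<inter> \<Inter>\<B>) = card {z. z \<in> X \<and> (\<forall>H\<in>\<B>. z \<in> H)}"
      by (rule arg_cong[where f = card]) auto
    finally show "?q ^ flat_dim (X \<inter> \<Inter>\<B>) = (\<Sum>z | z \<in> X \<and> (\<forall>H\<in>\<B>. z \<in> H). 1)"
      by (simp only: sum_constant mult_1_right of_nat_1)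
  qed
  also have "\<dots> = (\<Sum>z | z \<in> X \<and> (\<forall>H\<in>R. z \<notin> H). 1)"
    using finX finR by (rule inclusion_exclusion_weighted[rotated])
  also have "{z. z \<in> X \<and> (\<forall>H\<in>R. z \<notin> H)} = arr_complement X R"
    by (auto simp: arr_complement_def)
  finally show ?thesis by simp
qed

text \<open>
  Induction on \<open>R\<close>, adding a subspace \<open>H\<close>. Take \<open>y\<close> in \<open>X\<close> outside all members of \<open>R\<close>, which exists by induction, and \<open>x\<close> in \<open>X\<close> outside \<open>H\<close>. If
  \<open>y\<close> is in \<open>H\<close>, the line of all \<open>x + c y\<close> misses \<open>H\<close> and meets each member of \<open>R\<close> in at most one point,
  since a subspace with two of its points would contain \<open>y\<close>.
\<close>

lemma subspace_not_finite_Union: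
  fixes X :: "('a \<Rightarrow> 'f::field) set"
  assumes inf: "infinite (UNIV :: 'f set)" and X: "fun_space.subspace X" and "finite R"
    and "\<forall>H\<in>R. fun_space.subspace H \<and> \<not> X \<subseteq> H"
  shows "\<not> X \<subseteq> \<Union>R"
  using assms(3,4)
proof (induction R)
  case empty
  then show ?case using fun_space.subspace_0[OF X] by auto
next
  case (insert H R)
  obtain y where y: "y \<in> X" "y \<notin> \<Union>R" using insert by blast
  obtain x where x: "x \<in> X" "x \<notin> H" using insert.prems by blast
  have subH: "fun_space.subspace H" using insert.prems by blast
  show ?case
  proof (cases "y \<in> H")
    case False
    then show ?thesis using y by auto
  next
    case True
    \<comment> \<open>The parameters of the points of the line that lie in \<open>K\<close>.\<close>
    define bad where "bad K = {c. x + (\<lambda>a. c * y a) \<in> K}" for K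
    have "finite (bad K)" if K: "K \<in> R" for K
    proof -
      have subK: "fun_space.subspace K" using insert.prems K by blast
      have "c = d" if cd: "c \<in> bad K" "d \<in> bad K" for c d
      proof (rule ccontr)
        assume "c \<noteq> d"
        have "(x + (\<lambda>a. c * y a)) - (x + (\<lambda>a. d * y a)) \<in> K"
          using cd subK unfolding bad_def by (blast intro: fun_space.subspace_diff)
        then have "(\<lambda>a. inverse (c - d) * ((x + (\<lambda>a. c * y a)) - (x + (\<lambda>a. d * y a))) a) \<in> K"
          by (rule fun_space.subspace_scale[OF subK])
        moreover have "(\<lambda>a. inverse (c - d) * ((x + (\<lambda>a. c * y a)) - (x + (\<lambda>a. d * y a))) a) = y"
          using \<open>c \<noteq> d\<close> by (auto simp: field_simps)
        ultimately show False using y(2) K by auto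
      qed
      then show ?thesis by (metis finite.simps is_singletonI' is_singleton_def)
    qed
    then have "finite (\<Union>K\<in>R. bad K)" using insert.hyps by blast
    then obtain c where c: "c \<notin> (\<Union>K\<in>R. bad K)" using inf ex_new_if_finite by blast
    let ?z = "x + (\<lambda>a. c * y a)"
    have "?z \<in> X" using x y X by (intro fun_space.subspace_add fun_space.subspace_scale) auto
    moreover have "?z \<notin> H"
    proof
      assume "?z \<in> H"
      then have "?z - (\<lambda>a. c * y a) \<in> H"
        using True subH by (blast intro: fun_space.subspace_diff fun_space.subspace_scale)
      then show False using x by simp
    qed
    moreover have "?z \<notin> \<Union>R" using c by (auto simp: bad_def)
    ultimately show ?thesis by blast
  qed
qed

section \<open>Block spaces of a partition\<close>

lemma subspace_block_space: "fun_space.subspace (block_space G p)"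
  by (auto simp: fun_space.subspace_def block_space_def coord_space_def sum.distrib
      sum_distrib_left[symmetric])

lemma sum_fun_apply: "(\<Sum>v\<in>A. F v) a = (\<Sum>v\<in>A. F v a)"
  for F :: "'i \<Rightarrow> 'a \<Rightarrow> 'f::comm_monoid_add"
  by (induction A rule: infinite_finite_induct) auto

text \<open>
  The map \<open>\<rho>\<close> sends a vertex to a chosen representative of its block.
\<close>

lemma partition_on_representatives:
  assumes "partition_on V p"
  shows "\<exists>\<rho>. (\<forall>U\<in>p. \<forall>v\<in>U. \<rho> v \<in> U) \<and> (\<forall>U\<in>p. \<forall>u\<in>U. \<forall>v\<in>U. \<rho> u = \<rho> v)
    \<and> card (\<rho> ` V) = card p"
proof -
  define blk where "blk v = (THE U. U \<in> p \<and> v \<in> U)" for v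
  define r where "r U = (SOME w. w \<in> U)" for U :: "'a set"
  have blk: "blk v = U" if "U \<in> p" "v \<in> U" for U v
    unfolding blk_def using that partition_onD2[OF assms] by (intro the_equality) (auto simp: disjoint_def)
  have r: "r U \<in> U" if "U \<in> p" for U
    using that partition_onD3[OF assms] someI_ex[of "\<lambda>w. w \<in> U"] unfolding r_def by fastforce
  have "inj_on r p"
    using blk r by (metis inj_onI)
  moreover have "(r \<circ> blk) ` V = r ` p"
  proof -
    have "blk ` V = p"
    proof
      show "blk ` V \<subseteq> p" using partition_onD1[OF assms] blk by auto
      show "p \<subseteq> blk ` V"
      proof
        fix U assume U: "U \<in> p"
        then have "blk (r U) = U" "r U \<in> V"
          using blk[OF U r[OF U]] r[OF U] partition_onD1[OF assms] by auto
        then show "U \<in> blk ` V" by (metis imageI)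
      qed
    qed
    then show ?thesis by (simp only: image_comp[symmetric])
  qed
  ultimately have "card ((r \<circ> blk) ` V) = card p" by (simp add: card_image)
  moreover have "(r \<circ> blk) v \<in> U" if "U \<in> p" "v \<in> U" for U v using that blk r by simp
  moreover have "(r \<circ> blk) u = (r \<circ> blk) v" if "U \<in> p" "u \<in> U" "v \<in> U" for U u v
    using that blk by simp
  ultimately show ?thesis by blast
qed

text \<open>
  The coefficient of a representative on the right-hand side is its own coordinate minus the sum
  over its block, and that sum is \<open>0\<close>. The differences \<open>\<delta>\<^sub>v - \<delta>\<^bsub>\<rho> v\<^esub>\<close> therefore span the block
  space, both for the count of the dimension and for the comparison with boundaries.
\<close>

lemma block_space_expansion:
  fixes x :: "'v \<Rightarrow> 'f::field"
  assumes p: "partition_on (verts G) p" and fin: "finite (verts G)" and x: "x \<in> block_space G p"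
    and \<rho>: "\<And>U v. \<lbrakk>U \<in> p; v \<in> U\<rbrakk> \<Longrightarrow> \<rho> v \<in> U"
      "\<And>U u v. \<lbrakk>U \<in> p; u \<in> U; v \<in> U\<rbrakk> \<Longrightarrow> \<rho> u = \<rho> v"
  shows "x = (\<Sum>v\<in>verts G. (\<lambda>a. x v * (of_bool (a = v) - of_bool (a = \<rho> v))))"
proof
  fix a
  have "(\<Sum>v | v \<in> verts G \<and> \<rho> v = a. x v) = 0"
  proof (cases "\<exists>v\<in>verts G. \<rho> v = a")
    case True
    then obtain v U where v: "v \<in> verts G" "\<rho> v = a" "U \<in> p" "v \<in> U"
      using partition_onD1[OF p] by auto
    have "u \<in> U" if "u \<in> verts G" "\<rho> u = a" for u
    proof -
      obtain U' where U': "U' \<in> p" "u \<in> U'" using \<open>u \<in> verts G\<close> partition_onD1[OF p] by auto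
      then have "a \<in> U'" "a \<in> U" using \<rho>(1) v that by metis+
      then show ?thesis using U' v(3) partition_onD2[OF p] by (auto simp: disjoint_def)
    qed
    moreover have "u \<in> verts G \<and> \<rho> u = a" if "u \<in> U" for u
      using that v \<rho>(2)[OF v(3) that v(4)] partition_onD1[OF p] by auto
    ultimately have "{v. v \<in> verts G \<and> \<rho> v = a} = U" by blast
    then show ?thesis using x v(3) by (simp add: block_space_def)
  next
    case False
    then have "{v. v \<in> verts G \<and> \<rho> v = a} = {}" by auto
    then show ?thesis by (metis sum.empty)
  qed
  moreover have "(\<Sum>v\<in>verts G. x v * of_bool (a = v)) = x a"
    using fin x by (auto simp: of_bool_def sum.delta' if_distrib[of "\<lambda>c. _ * c"] block_space_def coord_space_def
        cong: if_cong)
  moreover have "(\<Sum>v\<in>verts G. x v * of_bool (a = \<rho> v)) = (\<Sum>v | v \<in> verts G \<and> \<rho> v = a. x v)"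
    using fin by (intro sum.mono_neutral_cong_right) auto
  ultimately show "x a = (\<Sum>v\<in>verts G. (\<lambda>a. x v * (of_bool (a = v) - of_bool (a = \<rho> v)))) a"
    by (simp add: sum_fun_apply right_diff_distrib sum_subtractf)
qed

text \<open>
  The vectors \<open>\<delta>\<^sub>v - \<delta>\<^bsub>\<rho> v\<^esub>\<close> with \<open>v\<close> not a representative form a basis: at such a \<open>v\<close> only
  the vector indexed by \<open>v\<close> is nonzero.
\<close>

lemma dim_block_space:
  assumes p: "partition_on (verts G) p" and fin: "finite (verts G)"
  shows "fun_space.dim (block_space G p :: ('v \<Rightarrow> 'f::field) set) + card p = card (verts G)"
proof -
  obtain \<rho> where \<rho>_ex: "\<forall>U\<in>p. \<forall>v\<in>U. \<rho> v \<in> U" "\<forall>U\<in>p. \<forall>u\<in>U. \<forall>v\<in>U. \<rho> u = \<rho> v"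
    and card\<rho>: "card (\<rho> ` verts G) = card p"
    using partition_on_representatives[OF p] by (elim exE conjE)
  have \<rho>: "\<And>U v. \<lbrakk>U \<in> p; v \<in> U\<rbrakk> \<Longrightarrow> \<rho> v \<in> U"
    "\<And>U u v. \<lbrakk>U \<in> p; u \<in> U; v \<in> U\<rbrakk> \<Longrightarrow> \<rho> u = \<rho> v"
    using \<rho>_ex by blast+
  let ?V = "verts G" and ?W = "block_space G p :: ('v \<Rightarrow> 'f) set"
  define \<beta> :: "'v \<Rightarrow> 'v \<Rightarrow> 'f" where "\<beta> v = (\<lambda>a. of_bool (a = v) - of_bool (a = \<rho> v))" for v
  define N where "N = ?V - \<rho> ` ?V"
  have \<rho>V: "\<rho> v \<in> ?V" if "v \<in> ?V" for v
    using that \<rho>(1) partition_onD1[OF p] by auto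
  have \<rho>\<rho>: "\<rho> (\<rho> v) = \<rho> v" if "v \<in> ?V" for v
    using that \<rho> partition_onD1[OF p] by blast
  have \<beta>eval: "\<beta> v u = of_bool (u = v)" if "u \<in> N" "v \<in> ?V" for u v
    using that by (auto simp: \<beta>_def N_def)
  have \<beta>0: "\<beta> v = 0" if v: "v \<in> ?V - N" for v
  proof -
    have "\<rho> v = v" using v \<rho>\<rho> by (auto simp: N_def)
    then show ?thesis by (auto simp: \<beta>_def)
  qed
  have fN: "finite N" "N \<subseteq> ?V" using fin by (auto simp: N_def)
  have inj: "inj_on \<beta> N"
  proof (rule inj_onI)
    fix u v assume uv: "u \<in> N" "v \<in> N" "\<beta> u = \<beta> v"
    have "\<beta> u u = 1" "\<beta> v u = of_bool (u = v)"
      using \<beta>eval[of u u] \<beta>eval[of u v] uv(1,2) fN by auto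
    with uv(3) show "u = v" by (simp split: if_splits add: of_bool_def)
  qed
  have \<beta>W: "\<beta> v \<in> ?W" if v: "v \<in> ?V" for v
  proof -
    have "\<beta> v a = 0" if "a \<notin> ?V" for a using that v \<rho>V by (auto simp: \<beta>_def)
    moreover have "(\<Sum>a\<in>U. \<beta> v a) = 0" if U: "U \<in> p" for U
    proof -
      have "finite U" using U fin partition_onD1[OF p] by (auto intro: finite_subset)
      moreover have "v \<in> U \<longleftrightarrow> \<rho> v \<in> U"
      proof -
        obtain U' where U': "U' \<in> p" "v \<in> U'" using v partition_onD1[OF p] by auto
        then have "\<rho> v \<in> U'" using \<rho>(1) by blast
        then show ?thesis using U' U partition_onD2[OF p] by (auto simp: disjoint_def)
      qed
      ultimately show ?thesis by (simp add: \<beta>_def sum_subtractf of_bool_def sum.delta)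
    qed
    ultimately show ?thesis by (simp add: block_space_def coord_space_def)
  qed
  have ind: "fun_space.independent (\<beta> ` N)"
  proof (rule fun_space.independent_if_scalars_zero)
    fix f y assume f: "(\<Sum>x\<in>\<beta> ` N. (\<lambda>a. f x * x a)) = 0" and "y \<in> \<beta> ` N"
    then obtain u where u: "u \<in> N" "y = \<beta> u" by auto
    have "0 = (\<Sum>x\<in>\<beta> ` N. (\<lambda>a. f x * x a)) u" unfolding f by simp
    also have "\<dots> = (\<Sum>v\<in>N. f (\<beta> v) * \<beta> v u)"
      by (simp add: sum_fun_apply sum.reindex[OF inj])
    also have "\<dots> = (\<Sum>v\<in>N. f (\<beta> v) * of_bool (u = v))"
      using \<beta>eval u fN by (intro sum.cong) auto
    also have "\<dots> = f (\<beta> u)"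
      using u fN by (simp add: of_bool_def if_distrib[of "\<lambda>c. _ * c"] cong: if_cong)
    finally show "f y = 0" using u by simp
  qed (use fN in auto)
  have "?W \<subseteq> fun_space.span (\<beta> ` N)"
  proof
    fix x assume "x \<in> ?W"
    have "\<beta> v \<in> fun_space.span (\<beta> ` N)" if "v \<in> ?V" for v
      using that \<beta>0[of v] fun_space.span_zero by (cases "v \<in> N") (auto intro: fun_space.span_base)
    then have "(\<Sum>v\<in>?V. (\<lambda>a. x v * \<beta> v a)) \<in> fun_space.span (\<beta> ` N)"
      by (intro fun_space.span_sum fun_space.span_scale)
    then show "x \<in> fun_space.span (\<beta> ` N)"
      using block_space_expansion[OF p fin \<open>x \<in> ?W\<close> \<rho>] by (simp add: \<beta>_def)
  qed
  moreover have "\<beta> ` N \<subseteq> ?W" using \<beta>W fN by auto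
  ultimately have "fun_space.dim ?W = card (\<beta> ` N)"
    using ind fun_space.dim_unique by blast
  also have "\<dots> = card N" by (rule card_image[OF inj])
  also have "\<dots> = card ?V - card p"
  proof -
    have "\<rho> ` ?V \<subseteq> ?V" using \<rho>V by auto
    then show ?thesis
      using fin card\<rho> unfolding N_def by (simp add: card_Diff_subset finite_subset)
  qed
  finally show ?thesis
    using card\<rho> card_image_le[OF fin, of \<rho>] by simp
qed

section \<open>Components of spanning subgraphs\<close>

definition link :: "('v, 'e) pre_digraph \<Rightarrow> 'e set \<Rightarrow> 'v rel" where
  "link G S = (\<Union>e\<in>S. {(tail G e, head G e), (head G e, tail G e)})"

definition component :: "('v, 'e) pre_digraph \<Rightarrow> 'e set \<Rightarrow> 'v \<Rightarrow> 'v set" where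
  "component G S u = (link G S)\<^sup>* `` {u}"

lemma link_mono: "S \<subseteq> T \<Longrightarrow> link G S \<subseteq> link G T"
  by (auto simp: link_def)

lemma sym_link_rtrancl: "sym ((link G S)\<^sup>*)"
  by (intro sym_rtrancl) (auto simp: link_def sym_def)

lemma component_refl: "u \<in> component G S u"
  by (simp add: component_def)

lemma component_eq_iff: "component G S u = component G S v \<longleftrightarrow> (u, v) \<in> (link G S)\<^sup>*"
  using sym_link_rtrancl[of G S] unfolding component_def sym_def
  by (auto intro: rtrancl_trans)

lemma component_eqI: "v \<in> component G S u \<Longrightarrow> component G S v = component G S u"
  unfolding component_eq_iff using sym_link_rtrancl[of G S] by (auto simp: component_def sym_def)

lemma component_ends: "e \<in> S \<Longrightarrow> component G S (tail G e) = component G S (head G e)"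
  unfolding component_eq_iff by (auto simp: link_def)

text \<open>
  The ends of the new arc are named \<open>a\<close> and \<open>b\<close> in either order, as orientation is irrelevant to
  connectivity.
\<close>

lemma component_insert:
  assumes "{tail G e, head G e} = {a, b}"
  shows "component G (insert e S) u =
    (if component G S u \<in> {component G S a, component G S b}
     then component G S a \<union> component G S b else component G S u)"
proof -
  let ?r = "link G S"
  have L: "link G (insert e S) = insert (a, b) (insert (b, a) ?r)"
    using assms by (auto simp: link_def doubleton_eq_iff)
  have s: "(x, y) \<in> ?r\<^sup>* \<Longrightarrow> (y, x) \<in> ?r\<^sup>*" for x y
    using sym_link_rtrancl[of G S] by (auto simp: sym_def)
  have t: "(x, y) \<in> ?r\<^sup>* \<Longrightarrow> (y, z) \<in> ?r\<^sup>* \<Longrightarrow> (x, z) \<in> ?r\<^sup>*" for x y z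
    by (rule rtrancl_trans)
  have "(u, w) \<in> (link G (insert e S))\<^sup>* \<longleftrightarrow>
      (u, w) \<in> ?r\<^sup>* \<or> (((u, a) \<in> ?r\<^sup>* \<or> (u, b) \<in> ?r\<^sup>*) \<and> ((a, w) \<in> ?r\<^sup>* \<or> (b, w) \<in> ?r\<^sup>*))" for w
  proof
    assume "(u, w) \<in> (link G (insert e S))\<^sup>*"
    then show "(u, w) \<in> ?r\<^sup>* \<or> (((u, a) \<in> ?r\<^sup>* \<or> (u, b) \<in> ?r\<^sup>*) \<and> ((a, w) \<in> ?r\<^sup>* \<or> (b, w) \<in> ?r\<^sup>*))"
      unfolding L rtrancl_insert by blast
  next
    have r: "?r\<^sup>* \<subseteq> (link G (insert e S))\<^sup>*" by (intro rtrancl_mono link_mono) auto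
    have ab: "(a, b) \<in> (link G (insert e S))\<^sup>*" "(b, a) \<in> (link G (insert e S))\<^sup>*"
      unfolding L by auto
    assume "(u, w) \<in> ?r\<^sup>* \<or> (((u, a) \<in> ?r\<^sup>* \<or> (u, b) \<in> ?r\<^sup>*) \<and> ((a, w) \<in> ?r\<^sup>* \<or> (b, w) \<in> ?r\<^sup>*))"
    then show "(u, w) \<in> (link G (insert e S))\<^sup>*"
      using r ab by (meson rtrancl_trans subsetD)
  qed
  then have mem: "w \<in> component G (insert e S) u \<longleftrightarrow> (u, w) \<in> ?r\<^sup>* \<or>
      (((u, a) \<in> ?r\<^sup>* \<or> (u, b) \<in> ?r\<^sup>*) \<and> (w \<in> component G S a \<or> w \<in> component G S b))" for w
    by (simp add: component_def)
  show ?thesis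
  proof (cases "(u, a) \<in> ?r\<^sup>* \<or> (u, b) \<in> ?r\<^sup>*")
    case True
    then have "(a, w) \<in> ?r\<^sup>* \<or> (b, w) \<in> ?r\<^sup>*" if "(u, w) \<in> ?r\<^sup>*" for w
      using that by (meson s t)
    then have "w \<in> component G S a \<union> component G S b" if "(u, w) \<in> ?r\<^sup>*" for w
      using that by (simp add: component_def)
    then have "component G (insert e S) u = component G S a \<union> component G S b"
      using mem True by blast
    then show ?thesis using True by (simp add: component_eq_iff)
  next
    case False
    then have "component G (insert e S) u = component G S u"
      using mem by (auto simp: component_def)
    then show ?thesis using False by (simp add: component_eq_iff)
  qed
qed

context fin_digraph
begin

lemma component_subset_verts:
  assumes "S \<subseteq> arcs G" "u \<in> verts G" shows "component G S u \<subseteq> verts G"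
proof -
  have "v \<in> verts G" if "(u, v) \<in> (link G S)\<^sup>*" for v
    using that assms by (induction rule: rtrancl_induct) (auto simp: link_def)
  then show ?thesis by (auto simp: component_def)
qed

lemma comp_partition_eq:
  assumes S: "S \<subseteq> arcs G"
  shows "comp_partition G S = component G S ` verts G"
proof -
  let ?H = "with_proj (mk_symmetric (spanning_sub G S))"
  have ends: "arcs_ends ?H = link G S" and V: "verts ?H = verts G"
    by (auto simp: parcs_mk_symmetric spanning_sub_def link_def)
  have "u \<rightarrow>\<^sup>*\<^bsub>?H\<^esub> v \<longleftrightarrow> u \<in> verts G \<and> (u, v) \<in> (link G S)\<^sup>*" for u v
  proof
    assume "u \<rightarrow>\<^sup>*\<^bsub>?H\<^esub> v"
    then show "u \<in> verts G \<and> (u, v) \<in> (link G S)\<^sup>*"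
      unfolding reachable_def ends V using rtrancl_on_rtranclI in_rtrancl_on_in_F by metis
  next
    assume uv: "u \<in> verts G \<and> (u, v) \<in> (link G S)\<^sup>*"
    then have "(u, v) \<in> (link G S)\<^sup>*" by simp
    then have "(u, v) \<in> rtrancl_on (verts G) (link G S)"
    proof (induction rule: rtrancl_induct)
      case base then show ?case using uv by simp
    next
      case (step y z)
      then have "z \<in> verts G" using S by (auto simp: link_def)
      with step show ?case by (auto intro: rtrancl_on_into_rtrancl_on)
    qed
    then show "u \<rightarrow>\<^sup>*\<^bsub>?H\<^esub> v" unfolding reachable_def ends V .
  qed
  then show ?thesis
    unfolding comp_partition_def quotient_def component_def by auto
qed

lemma partition_on_comp_partition:
  assumes S: "S \<subseteq> arcs G"
  shows "partition_on (verts G) (comp_partition G S)"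
proof (rule partition_onI)
  show "\<Union>(comp_partition G S) = verts G"
    unfolding comp_partition_eq[OF S] using component_subset_verts[OF S] component_refl by fastforce
next
  fix p q assume "p \<in> comp_partition G S" "q \<in> comp_partition G S" "p \<noteq> q"
  then obtain u v where uv: "p = component G S u" "q = component G S v"
    unfolding comp_partition_eq[OF S] by blast
  then have "w \<notin> q" if "w \<in> p" for w
    using that \<open>p \<noteq> q\<close> component_eqI[of w G S u] component_eqI[of w G S v] by auto
  then show "disjnt p q" by (auto simp: disjnt_def)
next
  show "{} \<notin> comp_partition G S"
    unfolding comp_partition_eq[OF S] using component_refl by fastforce
qed

lemma finite_comp_partition: "S \<subseteq> arcs G \<Longrightarrow> finite (comp_partition G S)"
  by (simp add: comp_partition_eq)

lemma comp_partition_insert: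
  assumes S: "S \<subseteq> arcs G" and e: "e \<in> arcs G" and ab: "{tail G e, head G e} = {a, b}"
  shows "comp_partition G (insert e S) =
    insert (component G S a \<union> component G S b)
      (comp_partition G S - {component G S a, component G S b})"
proof -
  have a: "a \<in> verts G" using e ab by (metis head_in_verts insertI1 insert_absorb insert_iff singletonD tail_in_verts)
  have T: "insert e S \<subseteq> arcs G" using S e by simp
  have "comp_partition G (insert e S) = (\<lambda>u. if component G S u \<in> {component G S a, component G S b}
      then component G S a \<union> component G S b else component G S u) ` verts G"
    unfolding comp_partition_eq[OF T] component_insert[OF ab] by (rule refl)
  also have "\<dots> = insert (component G S a \<union> component G S b)
      (component G S ` verts G - {component G S a, component G S b})"
    using a by (intro subset_antisym subsetI) (auto simp: image_iff split: if_splits)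
  finally show ?thesis unfolding comp_partition_eq[OF S] .
qed

lemma card_comp_partition_insert:
  assumes S: "S \<subseteq> arcs G" and e: "e \<in> arcs G"
    and ne: "component G S (tail G e) \<noteq> component G S (head G e)"
  shows "card (comp_partition G S) = card (comp_partition G (insert e S)) + 1"
proof -
  let ?A = "component G S (tail G e)" and ?B = "component G S (head G e)"
  let ?R = "comp_partition G S - {?A, ?B}"
  have AB: "?A \<in> comp_partition G S" "?B \<in> comp_partition G S"
    using e by (auto simp: comp_partition_eq[OF S])
  have "?A \<union> ?B \<notin> ?R"
  proof
    assume "?A \<union> ?B \<in> ?R"
    then have "?A \<inter> (?A \<union> ?B) = {}"
      using AB partition_onD2[OF partition_on_comp_partition[OF S]]
      by (intro disjointD[of "comp_partition G S"]) auto
    then show False using component_refl[of "tail G e" G S] by blast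
  qed
  moreover have "card (comp_partition G S) = card ?R + 2"
  proof -
    have "card ?R = card (comp_partition G S) - card {?A, ?B}"
      using AB by (intro card_Diff_subset) auto
    moreover have "card {?A, ?B} = 2" using ne by simp
    moreover have "card {?A, ?B} \<le> card (comp_partition G S)"
      using AB finite_comp_partition[OF S] by (intro card_mono) auto
    ultimately show ?thesis by simp
  qed
  ultimately show ?thesis
    using finite_comp_partition[OF S] comp_partition_insert[OF S e refl] by simp
qed

text \<open>
  Arcs with both ends in one component leave the partition unchanged.
\<close>

lemma comp_partition_eqI:
  assumes S: "S \<subseteq> T" "T \<subseteq> arcs G"
    and same: "\<And>e. e \<in> T \<Longrightarrow> component G S (tail G e) = component G S (head G e)"
  shows "comp_partition G S = comp_partition G T"
proof -
  have "link G T \<subseteq> (link G S)\<^sup>*"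
    using same sym_link_rtrancl[of G S] unfolding component_eq_iff by (auto simp: link_def sym_def)
  moreover have "link G S \<subseteq> link G T" using S by (simp add: link_mono)
  ultimately have "(link G S)\<^sup>* = (link G T)\<^sup>*" by (metis rtrancl_subset)
  then show ?thesis using S by (simp add: comp_partition_eq component_def)
qed

text \<open>
  Each arc merges at most two components. This is the inequality that keeps the subtraction in
  \<open>nullity\<close> from truncating.
\<close>

lemma card_verts_le:
  assumes "S \<subseteq> arcs G"
  shows "card (verts G) \<le> card S + card (comp_partition G S)"
proof -
  have "finite S" using finite_subset[OF assms finite_arcs] .
  then show ?thesis using assms
  proof (induction S)
    case empty
    have "comp_partition G {} = (\<lambda>v. {v}) ` verts G"
      by (simp add: comp_partition_eq component_def link_def)
    then show ?case by (simp add: card_image)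
  next
    case (insert e S)
    have "card (comp_partition G S) \<le> card (comp_partition G (insert e S)) + 1"
    proof (cases "component G S (tail G e) = component G S (head G e)")
      case True
      then have "comp_partition G S = comp_partition G (insert e S)"
        using insert.prems component_ends[of _ S G] by (intro comp_partition_eqI) auto
      then show ?thesis by simp
    next
      case False
      then show ?thesis using card_comp_partition_insert[of S e] insert.prems by simp
    qed
    then show ?case using insert by simp
  qed
qed

end

section \<open>Boundaries and block sums\<close>

text \<open>
  Two distinct edges of a simple graph that share the vertex \<open>u\<close> have their other ends distinct.
  Below the vertices are the components of \<open>S\<close>, joined by the arcs between them.
\<close>

lemma doubleton_other:
  assumes "{a, b} \<noteq> {c, d}" "a \<noteq> b" "u \<in> {a, b} \<inter> {c, d}"
  shows "\<exists>w. {a, b} = {u, w} \<and> w \<notin> {c, d}"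
  using assms by auto

context fin_digraph
begin

lemma subspace_boundary_space: "fun_space.subspace (boundary_space G :: ('a \<Rightarrow> 'f::field) set)"
proof -
  have "boundary G (c + d) = boundary G c + boundary G d" for c d :: "'b \<Rightarrow> 'f"
    by (auto simp: boundary_def sum.distrib)
  moreover have "boundary G (\<lambda>e. k * c e) = (\<lambda>v. k * boundary G c v)" for k and c :: "'b \<Rightarrow> 'f"
    by (auto simp: boundary_def sum_distrib_left right_diff_distrib)
  moreover have "boundary G (0 :: 'b \<Rightarrow> 'f) = 0"
    by (auto simp: boundary_def)
  moreover note coord_space_subspace[of "arcs G"]
  ultimately show ?thesis
    unfolding fun_space.subspace_def boundary_space_def by (auto simp: image_iff) metis+
qed

text \<open>
  An arc carrying the value \<open>1\<close> has boundary \<open>\<delta>\<close> at its head minus \<open>\<delta>\<close> at its tail; along a path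
  these differences telescope.
\<close>

lemma vertex_difference_in_boundary_space:
  assumes "(u, w) \<in> (link G (arcs G))\<^sup>*"
  shows "(\<lambda>a. of_bool (a = u) - of_bool (a = w) :: 'f::field) \<in> boundary_space G"
  using assms
proof (induction rule: rtrancl_induct)
  case base
  have "(\<lambda>a. of_bool (a = u) - of_bool (a = u) :: 'f) = 0" by auto
  then show ?case using fun_space.subspace_0[OF subspace_boundary_space] by metis
next
  case (step y z)
  have edge: "(\<lambda>a. of_bool (a = head G e) - of_bool (a = tail G e) :: 'f) \<in> boundary_space G"
    if e: "e \<in> arcs G" for e
  proof -
    have "boundary G (\<lambda>e'. of_bool (e' = e)) a = (of_bool (a = head G e) - of_bool (a = tail G e) :: 'f)" for a
      using e by (simp add: boundary_def of_bool_def sum.delta finite_in_arcs finite_out_arcs)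
    moreover have "(\<lambda>e'. of_bool (e' = e)) \<in> coord_space (arcs G)"
      using e by (auto simp: coord_space_def)
    ultimately show ?thesis unfolding boundary_space_def by (intro image_eqI) auto
  qed
  obtain e where e: "e \<in> arcs G" "(y = tail G e \<and> z = head G e) \<or> (y = head G e \<and> z = tail G e)"
    using step.hyps by (auto simp: link_def)
  have "(\<lambda>a. of_bool (a = tail G e) - of_bool (a = head G e) :: 'f) =
      - (\<lambda>a. of_bool (a = head G e) - of_bool (a = tail G e))" by auto
  also have "\<dots> \<in> boundary_space G"
    by (rule fun_space.subspace_neg[OF subspace_boundary_space edge[OF e(1)]])
  finally have "(\<lambda>a. of_bool (a = y) - of_bool (a = z) :: 'f) \<in> boundary_space G"
    using e(2) edge[OF e(1)] by (elim disjE conjE) simp_all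
  with step.IH have "(\<lambda>a. of_bool (a = u) - of_bool (a = y) :: 'f) + (\<lambda>a. of_bool (a = y) - of_bool (a = z))
      \<in> boundary_space G"
    by (rule fun_space.subspace_add[OF subspace_boundary_space])
  moreover have "(\<lambda>a. of_bool (a = u) - of_bool (a = y) :: 'f) + (\<lambda>a. of_bool (a = y) - of_bool (a = z))
      = (\<lambda>a. of_bool (a = u) - of_bool (a = z))" by auto
  ultimately show ?case by simp
qed

text \<open>
  A boundary sums to \<open>0\<close> over a component because each arc of \<open>G\<close> with one end in it has both ends in
  it, and its two contributions cancel. Conversely, vectors with vanishing component sums are
  combinations of differences of connected vertices.
\<close>

lemma boundary_space_eq_block_space:
  "boundary_space G = (block_space G (comp_partition G (arcs G)) :: ('a \<Rightarrow> 'f::field) set)"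
proof
  let ?p = "comp_partition G (arcs G)"
  have p: "partition_on (verts G) ?p" by (rule partition_on_comp_partition) simp
  show "boundary_space G \<subseteq> (block_space G ?p :: ('a \<Rightarrow> 'f) set)"
  proof
    fix x :: "'a \<Rightarrow> 'f" assume "x \<in> boundary_space G"
    then obtain c where x: "x = boundary G c" by (auto simp: boundary_space_def)
    have "x v = 0" if "v \<notin> verts G" for v
    proof -
      have "in_arcs G v = {}" "out_arcs G v = {}" using that by (auto simp: in_arcs_def out_arcs_def)
      then show ?thesis by (simp add: x boundary_def)
    qed
    moreover have "(\<Sum>v\<in>U. x v) = 0" if U: "U \<in> ?p" for U
    proof -
      have finU: "finite U" using U partition_onD1[OF p] finite_subset[OF _ finite_verts, of U] by auto
      \<comment> \<open>Used with \<open>head G\<close> and with \<open>tail G\<close> for \<open>h\<close>.\<close>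
      have incidence: "(\<Sum>v\<in>U. \<Sum>e | e \<in> arcs G \<and> h e = v. c e) = (\<Sum>e | e \<in> arcs G \<and> h e \<in> U. c e)"
        for h :: "'b \<Rightarrow> 'a"
      proof -
        have "(\<Sum>e | e \<in> arcs G \<and> h e \<in> U. c e) = (\<Sum>v\<in>U. \<Sum>e | e \<in> {e \<in> arcs G. h e \<in> U} \<and> h e = v. c e)"
          using finU by (intro sum.group[symmetric]) auto
        also have "\<dots> = (\<Sum>v\<in>U. \<Sum>e | e \<in> arcs G \<and> h e = v. c e)"
          by (intro sum.cong) auto
        finally show ?thesis by simp
      qed
      have "tail G e \<in> U \<longleftrightarrow> head G e \<in> U" if "e \<in> arcs G" for e
      proof -
        obtain u where "U = component G (arcs G) u" using U comp_partition_eq[of "arcs G"] by auto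
        moreover have "component G (arcs G) (tail G e) = component G (arcs G) (head G e)"
          using that by (rule component_ends)
        ultimately show ?thesis using component_eqI component_refl by metis
      qed
      then have "{e. e \<in> arcs G \<and> head G e \<in> U} = {e. e \<in> arcs G \<and> tail G e \<in> U}" by auto
      then show ?thesis
        unfolding x boundary_def in_arcs_def out_arcs_def sum_subtractf incidence by simp
    qed
    ultimately show "x \<in> block_space G ?p" by (simp add: block_space_def coord_space_def)
  qed
  show "(block_space G ?p :: ('a \<Rightarrow> 'f) set) \<subseteq> boundary_space G"
  proof
    fix x :: "'a \<Rightarrow> 'f" assume x: "x \<in> block_space G ?p"
    obtain \<rho> where \<rho>_ex: "\<forall>U\<in>?p. \<forall>v\<in>U. \<rho> v \<in> U" "\<forall>U\<in>?p. \<forall>u\<in>U. \<forall>v\<in>U. \<rho> u = \<rho> v"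
      using partition_on_representatives[OF p] by (elim exE conjE)
    have \<rho>: "\<And>U v. \<lbrakk>U \<in> ?p; v \<in> U\<rbrakk> \<Longrightarrow> \<rho> v \<in> U"
      "\<And>U u v. \<lbrakk>U \<in> ?p; u \<in> U; v \<in> U\<rbrakk> \<Longrightarrow> \<rho> u = \<rho> v"
      using \<rho>_ex by blast+
    have "(\<lambda>a. of_bool (a = v) - of_bool (a = \<rho> v) :: 'f) \<in> boundary_space G" if "v \<in> verts G" for v
    proof (rule vertex_difference_in_boundary_space)
      have "component G (arcs G) v \<in> ?p" using that comp_partition_eq[of "arcs G"] by auto
      then have "\<rho> v \<in> component G (arcs G) v" using \<rho>(1) component_refl by metis
      then show "(v, \<rho> v) \<in> (link G (arcs G))\<^sup>*" by (simp add: component_def)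
    qed
    then have "(\<Sum>v\<in>verts G. (\<lambda>a. x v * (of_bool (a = v) - of_bool (a = \<rho> v)))) \<in> boundary_space G"
      by (intro fun_space.subspace_sum fun_space.subspace_scale subspace_boundary_space)
    then show "x \<in> boundary_space G"
      using block_space_expansion[OF p finite_verts x \<rho>] by simp
  qed
qed

lemma sum_component_Un:
  fixes x :: "'a \<Rightarrow> 'f::field"
  assumes S: "S \<subseteq> arcs G" and U: "U \<in> comp_partition G S" "U' \<in> comp_partition G S" "U \<noteq> U'"
  shows "(\<Sum>v\<in>U \<union> U'. x v) = (\<Sum>v\<in>U. x v) + (\<Sum>v\<in>U'. x v)"
proof -
  note p = partition_on_comp_partition[OF S]
  have "U \<inter> U' = {}" using U partition_onD2[OF p] by (intro disjointD) auto
  moreover have "finite U" "finite U'"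
    using U partition_onD1[OF p] finite_subset[OF _ finite_verts] by auto
  ultimately show ?thesis by (simp add: sum.union_disjoint)
qed

text \<open>
  Adding arcs one at a time, each merger of two blocks adds two vanishing block sums.
\<close>

lemma block_space_mono:
  assumes "S \<subseteq> T" and T: "T \<subseteq> arcs G"
  shows "block_space G (comp_partition G S) \<subseteq>
    (block_space G (comp_partition G T) :: ('a \<Rightarrow> 'f::field) set)"
proof -
  have "finite (T - S)" using T finite_subset[OF T finite_arcs] by simp
  moreover have "block_space G (comp_partition G S) \<subseteq>
      (block_space G (comp_partition G (S \<union> D)) :: ('a \<Rightarrow> 'f) set)"
    if "finite D" "S \<union> D \<subseteq> arcs G" for D
    using that
  proof (induction D)
    case empty
    then show ?case by simp
  next
    case (insert e D)
    let ?S = "S \<union> D"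
    have S: "?S \<subseteq> arcs G" "e \<in> arcs G" using insert.prems by auto
    let ?A = "component G ?S (tail G e)" and ?B = "component G ?S (head G e)"
    have AB: "?A \<in> comp_partition G ?S" "?B \<in> comp_partition G ?S"
      using S by (auto simp: comp_partition_eq)
    have "block_space G (comp_partition G ?S) \<subseteq>
        (block_space G (comp_partition G (insert e ?S)) :: ('a \<Rightarrow> 'f) set)"
    proof
      fix x :: "'a \<Rightarrow> 'f" assume x: "x \<in> block_space G (comp_partition G ?S)"
      then have "(\<Sum>v\<in>?A \<union> ?B. x v) = 0"
        using sum_component_Un[OF S(1) AB, of x] AB by (cases "?A = ?B") (auto simp: block_space_def)
      with x show "x \<in> block_space G (comp_partition G (insert e ?S))"
        unfolding comp_partition_insert[OF S refl] by (auto simp: block_space_def)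
    qed
    then show ?case using insert S by auto
  qed
  ultimately show ?thesis using assms by (metis Diff_partition)
qed

text \<open>
  Induction on the number of arcs outside \<open>S\<close>. Contract the components of \<open>S\<close> to points. If no arc
  is left between distinct points, \<open>\<pi>(S)\<close> is \<open>\<pi>(E(G))\<close>, whose block space is the boundary space.
  If all remaining arcs join one and the same pair of points, \<open>\<pi>(S)\<close> has one block more than \<open>\<pi>(E(G))\<close>
  and the hypothesis applies to \<open>S\<close> itself. Otherwise there are arcs \<open>e\<close> and \<open>f\<close> joining
  different pairs. By induction the block sums vanish after contracting \<open>e\<close> and after contracting \<open>f\<close>:
  the sum at a point off \<open>e\<close> or off \<open>f\<close> is \<open>0\<close>, and the sum at a common end of \<open>e\<close> and \<open>f\<close>
  is minus the sum at the other end of \<open>e\<close>, which is off \<open>f\<close>.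
\<close>

lemma block_space_bond_intersection:
  fixes x :: "'a \<Rightarrow> 'f::field"
  assumes "S \<subseteq> arcs G" and x: "x \<in> boundary_space G"
    and bond: "\<And>T. \<lbrakk>S \<subseteq> T; T \<subseteq> arcs G; card (comp_partition G T) = card (comp_partition G (arcs G)) + 1\<rbrakk>
      \<Longrightarrow> x \<in> block_space G (comp_partition G T)"
  shows "x \<in> block_space G (comp_partition G S)"
  using assms(1) bond
proof (induction "card (arcs G - S)" arbitrary: S rule: less_induct)
  case less
  note S = \<open>S \<subseteq> arcs G\<close>
  let ?c = "component G S"
  have step: "x \<in> block_space G (comp_partition G (insert e S))"
    if "e \<in> arcs G" "?c (tail G e) \<noteq> ?c (head G e)" for e
  proof (rule less.hyps)
    have "e \<notin> S" using that component_ends by metis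
    then show "card (arcs G - insert e S) < card (arcs G - S)"
      using that by (intro psubset_card_mono) auto
  qed (use that S less.prems in auto)
  show ?case
  proof (cases "\<exists>e\<in>arcs G. ?c (tail G e) \<noteq> ?c (head G e)")
    case False
    then have "comp_partition G S = comp_partition G (arcs G)"
      using S by (intro comp_partition_eqI) auto
    then show ?thesis using x boundary_space_eq_block_space by auto
  next
    case True
    then obtain e where e: "e \<in> arcs G" "?c (tail G e) \<noteq> ?c (head G e)" by blast
    show ?thesis
    proof (cases "\<exists>f\<in>arcs G. ?c (tail G f) \<noteq> ?c (head G f) \<and>
        {?c (tail G f), ?c (head G f)} \<noteq> {?c (tail G e), ?c (head G e)}")
      case False
      have "comp_partition G (insert e S) = comp_partition G (arcs G)"
      proof (rule comp_partition_eqI)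
        fix f assume f: "f \<in> arcs G"
        show "component G (insert e S) (tail G f) = component G (insert e S) (head G f)"
        proof (cases "?c (tail G f) = ?c (head G f)")
          case True
          then show ?thesis unfolding component_insert[OF refl] by simp
        next
          case ne: False
          then have "{?c (tail G f), ?c (head G f)} = {?c (tail G e), ?c (head G e)}"
            using False f by blast
          then have "?c (tail G f) \<in> {?c (tail G e), ?c (head G e)}" "?c (head G f) \<in> {?c (tail G e), ?c (head G e)}"
            by blast+
          then show ?thesis unfolding component_insert[OF refl] by simp
        qed
      qed (use e S in auto)
      then have "card (comp_partition G S) = card (comp_partition G (arcs G)) + 1"
        using card_comp_partition_insert[OF S e] by simp
      then show ?thesis using less.prems(2)[of S] S by simp
    next
      case True
      then obtain f where f: "f \<in> arcs G" "?c (tail G f) \<noteq> ?c (head G f)"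
        and ef: "{?c (tail G f), ?c (head G f)} \<noteq> {?c (tail G e), ?c (head G e)}" by blast
      have merged: "U \<in> comp_partition G S \<Longrightarrow> U \<notin> {?c (tail G d), ?c (head G d)} \<Longrightarrow> (\<Sum>v\<in>U. x v) = 0"
        "(\<Sum>v\<in>?c (tail G d). x v) + (\<Sum>v\<in>?c (head G d). x v) = 0"
        if d: "d \<in> arcs G" "?c (tail G d) \<noteq> ?c (head G d)" for d U
      proof -
        have mem: "?c (tail G d) \<in> comp_partition G S" "?c (head G d) \<in> comp_partition G S"
          using d S by (auto simp: comp_partition_eq)
        have "\<forall>U\<in>insert (?c (tail G d) \<union> ?c (head G d)) (comp_partition G S - {?c (tail G d), ?c (head G d)}).
            (\<Sum>v\<in>U. x v) = 0"
          using step[OF d] unfolding comp_partition_insert[OF S d(1) refl] by (simp add: block_space_def)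
        then show "U \<in> comp_partition G S \<Longrightarrow> U \<notin> {?c (tail G d), ?c (head G d)} \<Longrightarrow> (\<Sum>v\<in>U. x v) = 0"
          "(\<Sum>v\<in>?c (tail G d). x v) + (\<Sum>v\<in>?c (head G d). x v) = 0"
          unfolding sum_component_Un[OF S mem d(2), symmetric] by auto
      qed
      have "(\<Sum>v\<in>U. x v) = 0" if U: "U \<in> comp_partition G S" for U
      proof (cases "U \<in> {?c (tail G e), ?c (head G e)} \<inter> {?c (tail G f), ?c (head G f)}")
        case False
        then show ?thesis using merged(1)[OF e U] merged(1)[OF f U] by blast
      next
        case True
        then obtain U' where U': "{?c (tail G e), ?c (head G e)} = {U, U'}"
          and "U' \<notin> {?c (tail G f), ?c (head G f)}"
          using doubleton_other[OF ef[symmetric] e(2) True] by (elim exE conjE)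
        moreover have "U' \<in> comp_partition G S"
        proof -
          have "{?c (tail G e), ?c (head G e)} \<subseteq> comp_partition G S"
            using e S by (auto simp: comp_partition_eq)
          then show ?thesis unfolding U' by simp
        qed
        ultimately have "(\<Sum>v\<in>U'. x v) = 0" using merged(1)[OF f] by blast
        moreover have "(\<Sum>v\<in>U. x v) + (\<Sum>v\<in>U'. x v) = 0"
          using merged(2)[OF e] U' unfolding doubleton_eq_iff by (elim disjE conjE) (simp_all add: add.commute)
        ultimately show ?thesis by simp
      qed
      moreover have "x \<in> coord_space (verts G)" using step[OF e] by (simp add: block_space_def)
      ultimately show ?thesis by (simp add: block_space_def)
    qed
  qed
qed

section \<open>Arcs on cycles\<close>

text \<open>
  A path is extended by one arc at a time; if the new vertex has been visited before, the path is cut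
  back to that visit.
\<close>

lemma simple_path_exists:
  assumes "(u, w) \<in> (link G S)\<^sup>*" and u: "u \<in> verts G" and S: "S \<subseteq> arcs G"
  shows "\<exists>vs es. length vs = Suc (length es) \<and> distinct vs \<and> set vs \<subseteq> verts G \<and> set es \<subseteq> S \<and>
    vs ! 0 = u \<and> vs ! length es = w \<and> (\<forall>i < length es. joins G (es ! i) (vs ! i) (vs ! Suc i))"
  using assms(1)
proof (induction rule: rtrancl_induct)
  case base
  show ?case using u by (intro exI[of _ "[u]"] exI[of _ "[]"]) auto
next
  case (step y z)
  then obtain vs es where p: "length vs = Suc (length es)" "distinct vs" "set vs \<subseteq> verts G" "set es \<subseteq> S"
    "vs ! 0 = u" "vs ! length es = y" "\<And>i. i < length es \<Longrightarrow> joins G (es ! i) (vs ! i) (vs ! Suc i)"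
    by blast
  obtain e where e: "e \<in> S" "joins G e y z" using step.hyps by (auto simp: link_def joins_def)
  have z: "z \<in> verts G" using e S by (auto simp: joins_def)
  show ?case
  proof (cases "z \<in> set vs")
    case False
    have "joins G ((es @ [e]) ! i) ((vs @ [z]) ! i) ((vs @ [z]) ! Suc i)" if "i < length (es @ [e])" for i
      using that p e by (cases "i < length es") (auto simp: nth_append less_Suc_eq)
    then show ?thesis using p e z False
      by (intro exI[of _ "vs @ [z]"] exI[of _ "es @ [e]"]) (auto simp: nth_append)
  next
    case True
    then obtain k where k: "k < length vs" "vs ! k = z" by (auto simp: in_set_conv_nth)
    then have len: "length (take k es) = k" "length (take (Suc k) vs) = Suc k" using p(1) by auto
    have "set (take (Suc k) vs) \<subseteq> verts G" "set (take k es) \<subseteq> S"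
      using p(3,4) set_take_subset[of "Suc k" vs] set_take_subset[of k es] by blast+
    moreover have "distinct (take (Suc k) vs)" using p(2) by simp
    moreover have "\<forall>i<k. joins G (take k es ! i) (take (Suc k) vs ! i) (take (Suc k) vs ! Suc i)"
      using p(7) len(1) by auto
    moreover have "take (Suc k) vs ! 0 = u" "take (Suc k) vs ! k = z" using p(5) k by auto
    ultimately show ?thesis
      by (intro exI[of _ "take (Suc k) vs"] exI[of _ "take k es"]) (simp only: len simp_thms)
  qed
qed

text \<open>
  A simple path in \<open>S\<close> between the ends of \<open>e\<close> is closed up by \<open>e\<close>. Its arcs are distinct since two
  equal arcs would join the same two of its vertices.
\<close>

lemma cyc_edgesI:
  assumes S: "S \<subseteq> arcs G" and e: "e \<in> arcs G" "e \<notin> S"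
    and conn: "component G S (tail G e) = component G S (head G e)"
  shows "e \<in> cyc_edges G"
proof -
  have "(tail G e, head G e) \<in> (link G S)\<^sup>*" using conn component_eq_iff by metis
  then obtain vs es where p: "length vs = Suc (length es)" "distinct vs" "set vs \<subseteq> verts G" "set es \<subseteq> S"
    "vs ! 0 = tail G e" "vs ! length es = head G e"
    "\<And>i. i < length es \<Longrightarrow> joins G (es ! i) (vs ! i) (vs ! Suc i)"
    using simple_path_exists[OF _ _ S] e(1) tail_in_verts by blast
  have "i = j" if ij: "i < length es" "j < length es" "es ! i = es ! j" for i j
  proof -
    have "{vs ! i, vs ! Suc i} = {vs ! j, vs ! Suc j}"
      using p(7)[OF ij(1)] p(7)[OF ij(2)] ij(3) by (auto simp: joins_def)
    then show ?thesis
      using p(1,2) ij by (auto simp: doubleton_eq_iff nth_eq_iff_index_eq)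
  qed
  then have "distinct es" by (auto simp: distinct_conv_nth)
  moreover have "joins G ((es @ [e]) ! i) (vs ! i) (vs ! (Suc i mod length (es @ [e])))"
    if "i < length (es @ [e])" for i
  proof (cases "i < length es")
    case True
    then have "Suc i mod length (es @ [e]) = Suc i" by simp
    then show ?thesis using True p(7)[OF True] by (simp add: nth_append)
  next
    case False
    then have "i = length es" using that by simp
    then show ?thesis using p(5,6) by (simp add: nth_append joins_def)
  qed
  ultimately have "undirected_cycle G vs (es @ [e])"
    using p e S unfolding undirected_cycle_def by auto
  then show ?thesis using e unfolding cyc_edges_def by force
qed

end

section \<open>Flats of the boundary arrangements\<close>

text \<open>
  The parameter \<open>C\<close> unifies the two arrangements of the theorem.
\<close>

definition partitions_above :: "('v, 'e) pre_digraph \<Rightarrow> 'e set \<Rightarrow> 'v set set set" where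
  "partitions_above G C = {comp_partition G S | S. S \<subseteq> arcs G \<and> C \<subseteq> S}"

lemma bond_partitions_eq: "bond_partitions G = partitions_above G {}"
  by (simp add: bond_partitions_def partitions_above_def)

lemma bond_partitions_cut_eq: "bond_partitions_cut G = partitions_above G (cut_edges G)"
  by (simp add: bond_partitions_cut_def partitions_above_def)

context fin_digraph
begin

text \<open>
  Membership in the restricted set of partitions depends on \<open>\<pi>(S)\<close> only, and yet it determines that
  \<open>S\<close> contains the cut edges: the ends of a cut edge share a block of \<open>\<pi>(S)\<close>, so the edge would
  lie on a cycle if it were missing from \<open>S\<close>.
\<close>

lemma cut_edges_subset_of_partition:
  assumes S: "S \<subseteq> arcs G" and mem: "comp_partition G S \<in> partitions_above G (cut_edges G)"
  shows "cut_edges G \<subseteq> S"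
proof
  fix e assume e: "e \<in> cut_edges G"
  then have eG: "e \<in> arcs G" "e \<notin> cyc_edges G" by (auto simp: cut_edges_def)
  obtain T where T: "T \<subseteq> arcs G" "cut_edges G \<subseteq> T" "comp_partition G S = comp_partition G T"
    using mem by (auto simp: partitions_above_def)
  have "component G T (tail G e) \<in> comp_partition G S"
    unfolding T(3) comp_partition_eq[OF T(1)] using eG by simp
  then obtain u where u: "component G T (tail G e) = component G S u"
    unfolding comp_partition_eq[OF S] by auto
  have "component G T (tail G e) = component G T (head G e)"
    using e T(2) by (intro component_ends) auto
  then have "tail G e \<in> component G S u" "head G e \<in> component G S u"
    using u component_refl by metis+
  then have "component G S (tail G e) = component G S (head G e)"
    using component_eqI by metis
  then show "e \<in> S" using cyc_edgesI[OF S eG(1)] eG(2) by blast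
qed

lemma finite_boundary_arr: "finite (boundary_arr G (partitions_above G C))"
proof -
  have "boundary_arr G (partitions_above G C) \<subseteq> (\<lambda>S. block_space G (comp_partition G S)) ` Pow (arcs G)"
    by (auto simp: boundary_arr_def partitions_above_def)
  then show ?thesis using finite_subset by fastforce
qed

lemma subspace_boundary_arr: "\<forall>H\<in>boundary_arr G P. fun_space.subspace H"
  by (auto simp: boundary_arr_def subspace_block_space)

text \<open>
  The hyperplanes through a block space that are needed come from supersets \<open>T\<close> of \<open>S\<close>, which
  contain \<open>C\<close> along with \<open>S\<close>. This is why the same argument serves both arrangements.
\<close>

lemma block_space_flat:
  assumes S: "S \<subseteq> arcs G" "C \<subseteq> S"
  shows "block_space G (comp_partition G S) \<in>
    flats (boundary_space G :: ('a \<Rightarrow> 'f::field) set) (boundary_arr G (partitions_above G C))"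
proof -
  let ?U = "block_space G (comp_partition G S) :: ('a \<Rightarrow> 'f) set"
  define \<B> :: "('a \<Rightarrow> 'f) set set" where "\<B> = {block_space G (comp_partition G T) | T.
    S \<subseteq> T \<and> T \<subseteq> arcs G \<and> card (comp_partition G T) = card (comp_partition G (arcs G)) + 1}"
  have "\<B> \<subseteq> boundary_arr G (partitions_above G C)"
    using S unfolding \<B>_def boundary_arr_def partitions_above_def by blast
  moreover have "?U = boundary_space G \<inter> \<Inter>\<B>"
  proof (intro subset_antisym subsetI IntI InterI)
    fix x assume "x \<in> ?U"
    then show "x \<in> boundary_space G"
      unfolding boundary_space_eq_block_space using block_space_mono[OF S(1) subset_refl] by blast
    fix K assume "K \<in> \<B>"
    then show "x \<in> K" using block_space_mono \<open>x \<in> ?U\<close> unfolding \<B>_def by blast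
  next
    fix x assume x: "x \<in> boundary_space G \<inter> \<Inter>\<B>"
    show "x \<in> ?U"
    proof (rule block_space_bond_intersection[OF S(1)])
      fix T assume "S \<subseteq> T" "T \<subseteq> arcs G" "card (comp_partition G T) = card (comp_partition G (arcs G)) + 1"
      then have "block_space G (comp_partition G T) \<in> \<B>" unfolding \<B>_def by blast
      then show "x \<in> block_space G (comp_partition G T)" using x by blast
    qed (use x in simp)
  qed
  moreover have "?U \<noteq> {}" using fun_space.subspace_0[OF subspace_block_space] by blast
  ultimately have "\<exists>\<B>. ?U = boundary_space G \<inter> \<Inter>\<B> \<and>
      \<B> \<subseteq> boundary_arr G (partitions_above G C) \<and> boundary_space G \<inter> \<Inter>\<B> \<noteq> {}" by metis
  then show ?thesis unfolding flats_def by (rule CollectI)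
qed

text \<open>
  Every \<open>b\<close> in the complement has \<open>X\<close> as the smallest flat through it, so a block space contains \<open>b\<close>
  iff it contains \<open>X\<close>.
\<close>

lemma phi_flat_eq:
  fixes X :: "('a \<Rightarrow> 'f::field) set" and C :: "'b set"
  defines "A \<equiv> boundary_arr G (partitions_above G C)"
  assumes X: "X \<in> flats (boundary_space G) A"
    and ne: "arr_complement X (restrict_arr A X) \<noteq> {}"
  shows "phi_flat G (partitions_above G C) X = phi G {p \<in> partitions_above G C. X \<subseteq> block_space G p}"
proof -
  have "partitions_at G (partitions_above G C) b = {p \<in> partitions_above G C. X \<subseteq> block_space G p}"
    if b: "b \<in> arr_complement X (restrict_arr A X)" for b
  proof -
    have "b \<in> block_space G p \<longleftrightarrow> X \<subseteq> block_space G p" if "p \<in> partitions_above G C" for p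
    proof
      have "block_space G p \<in> flats (boundary_space G) A"
        using that block_space_flat unfolding A_def partitions_above_def by blast
      then show "b \<in> block_space G p \<Longrightarrow> X \<subseteq> block_space G p"
        by (rule flat_avoiding_restriction[OF X _ b])
      show "X \<subseteq> block_space G p \<Longrightarrow> b \<in> block_space G p"
        using b by (auto simp: arr_complement_def)
    qed
    then show ?thesis by (auto simp: partitions_at_def)
  qed
  then show ?thesis
    using ne unfolding phi_flat_def A_def[symmetric] by (intro the_equality) auto
qed

section \<open>Exchanging the sums\<close>

lemma sum_signed_monomials:
  fixes C :: "'b set"
  assumes C: "C \<subseteq> arcs G"
  shows "(\<Sum>S | S \<subseteq> arcs G \<and> C \<subseteq> S. monom ((-1) ^ card (arcs G - S)) (card S)) =
    ([:0, 1:] ^ card C * [:-1, 1:] ^ card (arcs G - C) :: int poly)"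
proof -
  let ?D = "arcs G - C"
  have fin: "finite C" "finite ?D" using C finite_subset[OF C finite_arcs] by auto
  have "(\<Sum>S | S \<subseteq> arcs G \<and> C \<subseteq> S. monom ((-1) ^ card (arcs G - S)) (card S)) =
      (\<Sum>T\<in>Pow ?D. [:0, 1:] ^ card C * ([:0, 1:] ^ card T * (-1) ^ card (?D - T)) :: int poly)"
  proof (rule sum.reindex_bij_witness[of _ "\<lambda>T. C \<union> T" "\<lambda>S. S - C"])
    fix S assume "S \<in> {S. S \<subseteq> arcs G \<and> C \<subseteq> S}"
    then have S: "S \<subseteq> arcs G" "C \<subseteq> S" by auto
    have "card S = card C + card (S - C)"
      using S fin finite_subset[OF S(1) finite_arcs] by (metis card_Diff_subset card_mono le_add_diff_inverse)
    moreover have "?D - (S - C) = arcs G - S" using S by auto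
    moreover have "(monom ((-1) ^ k) n :: int poly) = [:0, 1:] ^ n * (-1) ^ k" for k n
      by (cases "even k") (auto simp: monom_altdef)
    ultimately show "[:0, 1:] ^ card C * ([:0, 1:] ^ card (S - C) * (-1) ^ card (?D - (S - C))) =
        (monom ((-1) ^ card (arcs G - S)) (card S) :: int poly)"
      by (simp add: power_add mult.assoc)
  qed (use C in auto)
  also have "\<dots> = [:0, 1:] ^ card C * ([:0, 1:] + (-1)) ^ card ?D"
    unfolding sum_distrib_left[symmetric] binomial_sum_Pow[OF fin(2)] ..
  also have "[:0, 1:] + (-1) = ([:-1, 1:] :: int poly)" by (simp add: one_pCons)
  finally show ?thesis .
qed

text \<open>
  The identity common to both parts and to all fields, with \<open>\<phi>(X)\<close> in the form that makes sense even
  if the complement of \<open>\<A>/X\<close> is empty. The assumption \<open>closed\<close> turns the condition on \<open>\<pi>(S)\<close> into the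
  condition \<open>C \<subseteq> S\<close>.
\<close>

lemma sum_phi_char_poly:
  fixes C :: "'b set"
  defines "B \<equiv> (boundary_space G :: ('a \<Rightarrow> 'f::field) set)"
    and "A \<equiv> (boundary_arr G (partitions_above G C) :: ('a \<Rightarrow> 'f) set set)"
  assumes C: "C \<subseteq> arcs G"
    and closed: "\<And>S. \<lbrakk>S \<subseteq> arcs G; comp_partition G S \<in> partitions_above G C\<rbrakk> \<Longrightarrow> C \<subseteq> S"
  shows "(\<Sum>X\<in>flats B A. phi G {p \<in> partitions_above G C. X \<subseteq> block_space G p} *
      char_poly X (restrict_arr A X)) =
    [:0, 1:] ^ card C * [:-1, 1:] ^ card (arcs G - C)"
proof -
  let ?\<beta> = "\<lambda>S. block_space G (comp_partition G S) :: ('a \<Rightarrow> 'f) set"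
  let ?\<chi> = "\<lambda>X. char_poly X (restrict_arr A X)"
  define m :: "'b set \<Rightarrow> int poly" where "m S = monom ((-1) ^ card (arcs G - S)) (nullity G S)" for S
  define \<S> where "\<S> = {S. S \<subseteq> arcs G \<and> C \<subseteq> S}"
  have fin: "finite A" "finite (flats B A)" "finite \<S>"
    using finite_boundary_arr finite_flats unfolding A_def \<S>_def by auto
  have phi: "phi G {p \<in> partitions_above G C. X \<subseteq> block_space G p} = (\<Sum>S | S \<in> \<S> \<and> X \<subseteq> ?\<beta> S. m S)"
    for X :: "('a \<Rightarrow> 'f) set"
  proof -
    have "comp_partition G S \<in> partitions_above G C \<longleftrightarrow> C \<subseteq> S" if "S \<subseteq> arcs G" for S
      using that closed unfolding partitions_above_def by blast
    then show ?thesis unfolding phi_def m_def \<S>_def by (intro sum.cong) auto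
  qed
  have "(\<Sum>X\<in>flats B A. phi G {p \<in> partitions_above G C. X \<subseteq> block_space G p} * ?\<chi> X) =
      (\<Sum>S\<in>\<S>. \<Sum>X | X \<in> flats B A \<and> X \<subseteq> ?\<beta> S. m S * ?\<chi> X)"
    unfolding phi sum_distrib_right by (rule sum.swap_restrict[OF fin(2,3)])
  also have "\<dots> = (\<Sum>S\<in>\<S>. monom ((-1) ^ card (arcs G - S)) (card S))"
  proof (rule sum.cong[OF refl])
    fix S assume "S \<in> \<S>"
    then have S: "S \<subseteq> arcs G" "C \<subseteq> S" by (auto simp: \<S>_def)
    have "(\<Sum>X | X \<in> flats B A \<and> X \<subseteq> ?\<beta> S. ?\<chi> X) = monom 1 (flat_dim (?\<beta> S))"
      using fin(1) subspace_boundary_space subspace_boundary_arr block_space_flat[OF S]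
      unfolding A_def B_def by (rule sum_char_poly_restrict)
    moreover have "nullity G S + flat_dim (?\<beta> S) = card S"
      using dim_block_space[OF partition_on_comp_partition[OF S(1)] finite_verts, where ?'f = 'f]
        card_verts_le[OF S(1)]
      unfolding flat_dim_subspace[OF subspace_block_space] nullity_def num_comps_def by linarith
    ultimately show "(\<Sum>X | X \<in> flats B A \<and> X \<subseteq> ?\<beta> S. m S * ?\<chi> X) =
        monom ((-1) ^ card (arcs G - S)) (card S)"
      by (simp add: sum_distrib_left[symmetric] m_def mult_monom)
  qed
  finally show ?thesis unfolding \<S>_def sum_signed_monomials[OF C] .
qed

lemma sum_phi_flat_infinite:
  assumes "infinite (UNIV :: 'f::field set)" and C: "C \<subseteq> arcs G"
    and closed: "\<And>S. \<lbrakk>S \<subseteq> arcs G; comp_partition G S \<in> partitions_above G C\<rbrakk> \<Longrightarrow> C \<subseteq> S"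
  shows "[:0, 1:] ^ card C * [:-1, 1:] ^ card (arcs G - C) =
    (\<Sum>X\<in>flats (boundary_space G :: ('a \<Rightarrow> 'f) set) (boundary_arr G (partitions_above G C)).
      phi_flat G (partitions_above G C) X *
      char_poly X (restrict_arr (boundary_arr G (partitions_above G C)) X))"
proof -
  let ?A = "boundary_arr G (partitions_above G C) :: ('a \<Rightarrow> 'f) set set"
  have "phi_flat G (partitions_above G C) X = phi G {p \<in> partitions_above G C. X \<subseteq> block_space G p}"
    if X: "X \<in> flats (boundary_space G) ?A" for X
  proof (rule phi_flat_eq[OF X])
    have sub: "fun_space.subspace X"
      using subspace_flat[OF subspace_boundary_space subspace_boundary_arr X] .
    have "\<not> X \<subseteq> \<Union>(restrict_arr ?A X)"
    proof (rule subspace_not_finite_Union[OF assms(1) sub])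
      show "\<forall>H\<in>restrict_arr ?A X. fun_space.subspace H \<and> \<not> X \<subseteq> H"
        using subspace_restrict_arr[OF subspace_boundary_arr sub] by (auto simp: restrict_arr_def)
    qed (intro finite_restrict_arr finite_boundary_arr)
    then show "arr_complement X (restrict_arr ?A X) \<noteq> {}" by (auto simp: arr_complement_def)
  qed
  then show ?thesis using sum_phi_char_poly[OF C closed, where ?'f = 'f] by simp
qed

text \<open>
  Flats with an empty complement need separate care: their \<open>phi_flat\<close> is unspecified, but it is
  multiplied by the number of points of the complement.
\<close>

lemma sum_phi_flat_finite:
  assumes f: "finite (UNIV :: 'f::field set)" and C: "C \<subseteq> arcs G"
    and closed: "\<And>S. \<lbrakk>S \<subseteq> arcs G; comp_partition G S \<in> partitions_above G C\<rbrakk> \<Longrightarrow> C \<subseteq> S"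
  defines "q \<equiv> int (card (UNIV :: 'f set))"
  shows "q ^ card C * (q - 1) ^ card (arcs G - C) =
    (\<Sum>X\<in>flats (boundary_space G :: ('a \<Rightarrow> 'f) set) (boundary_arr G (partitions_above G C)).
      poly (phi_flat G (partitions_above G C) X) q *
      poly (char_poly X (restrict_arr (boundary_arr G (partitions_above G C)) X)) q)"
proof -
  let ?A = "boundary_arr G (partitions_above G C) :: ('a \<Rightarrow> 'f) set set"
  let ?\<phi> = "\<lambda>X. phi G {p \<in> partitions_above G C. X \<subseteq> block_space G p}"
  have "boundary_space G \<subseteq> {x :: 'a \<Rightarrow> 'f. \<forall>a. (a \<in> verts G \<longrightarrow> x a \<in> UNIV) \<and> (a \<notin> verts G \<longrightarrow> x a = 0)}"
    unfolding boundary_space_eq_block_space by (auto simp: block_space_def coord_space_def)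
  then have finB: "finite (boundary_space G :: ('a \<Rightarrow> 'f) set)"
    using finite_set_of_finite_funs[OF finite_verts f, of 0] finite_subset by blast
  have *: "poly (phi_flat G (partitions_above G C) X) q * poly (char_poly X (restrict_arr ?A X)) q =
      poly (?\<phi> X * char_poly X (restrict_arr ?A X)) q"
    if X: "X \<in> flats (boundary_space G) ?A" for X
  proof (cases "arr_complement X (restrict_arr ?A X) = {}")
    case True
    have sub: "fun_space.subspace X"
      using subspace_flat[OF subspace_boundary_space subspace_boundary_arr X] .
    have "finite X" using X finB by (auto simp: flats_def intro: finite_subset)
    then have "poly (char_poly X (restrict_arr ?A X)) q = int (card (arr_complement X (restrict_arr ?A X)))"
      unfolding q_def using subspace_restrict_arr[OF subspace_boundary_arr sub]
      by (intro char_poly_eq_card_complement[OF f _ sub] ballI finite_restrict_arr finite_boundary_arr)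
    then show ?thesis using True by simp
  next
    case False
    then show ?thesis using phi_flat_eq[OF X] by simp
  qed
  have id: "[:0, 1:] ^ card C * [:-1, 1:] ^ card (arcs G - C) =
      (\<Sum>X\<in>flats (boundary_space G) ?A. ?\<phi> X * char_poly X (restrict_arr ?A X))"
    by (rule sum_phi_char_poly[symmetric]) (use C closed in auto)
  have "q ^ card C * (q - 1) ^ card (arcs G - C) =
      poly ([:0, 1:] ^ card C * [:-1, 1:] ^ card (arcs G - C)) q"
    by (simp add: poly_power)
  also have "\<dots> = (\<Sum>X\<in>flats (boundary_space G) ?A. poly (?\<phi> X * char_poly X (restrict_arr ?A X)) q)"
    unfolding id by (rule poly_sum)
  finally show ?thesis by (simp only: * cong: sum.cong)
qed

end

theorem theorem2p6:
  fixes G :: "('v, 'e) pre_digraph"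
    and B :: "('v \<Rightarrow> 'f::field) set"
    and \<A> \<A>cut :: "('v \<Rightarrow> 'f) set set"
  defines "B \<equiv> boundary_space G"
    and "\<A> \<equiv> boundary_arr G (bond_partitions G)"
    and "\<A>cut \<equiv> boundary_arr G (bond_partitions_cut G)"
  assumes "fin_digraph G"
  shows
    "(infinite (UNIV :: 'f set) \<longrightarrow>
        [:-1, 1:] ^ card (arcs G) =
        (\<Sum>X \<in> flats B \<A>.
           phi_flat G (bond_partitions G) X * char_poly X (restrict_arr \<A> X)))
     \<and>
     (\<forall>q. finite (UNIV :: 'f set) \<and> q = int (card (UNIV :: 'f set)) \<longrightarrow>
        (q - 1) ^ card (arcs G) =
        (\<Sum>X \<in> flats B \<A>.
           poly (phi_flat G (bond_partitions G) X) q * poly (char_poly X (restrict_arr \<A> X)) q))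
     \<and>
     (infinite (UNIV :: 'f set) \<longrightarrow>
        [:0, 1:] ^ card (cut_edges G) * [:-1, 1:] ^ card (cyc_edges G) =
        (\<Sum>X \<in> flats B \<A>cut.
           phi_flat G (bond_partitions_cut G) X * char_poly X (restrict_arr \<A>cut X)))
     \<and>
     (\<forall>q. finite (UNIV :: 'f set) \<and> q = int (card (UNIV :: 'f set)) \<longrightarrow>
        q ^ card (cut_edges G) * (q - 1) ^ card (cyc_edges G) =
        (\<Sum>X \<in> flats B \<A>cut.
           poly (phi_flat G (bond_partitions_cut G) X) q *
           poly (char_poly X (restrict_arr \<A>cut X)) q))"
proof -
  interpret fin_digraph G by fact
  have cut: "cut_edges G \<subseteq> arcs G" "arcs G - cut_edges G = cyc_edges G"
    by (auto simp: cut_edges_def cyc_edges_def)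
  show ?thesis
    unfolding B_def \<A>_def \<A>cut_def bond_partitions_eq bond_partitions_cut_eq
    using sum_phi_flat_infinite[where ?'f = 'f, of "{}"] sum_phi_flat_finite[where ?'f = 'f, of "{}"]
      sum_phi_flat_infinite[where ?'f = 'f, OF _ cut(1) cut_edges_subset_of_partition]
      sum_phi_flat_finite[where ?'f = 'f, OF _ cut(1) cut_edges_subset_of_partition]
    unfolding cut(2) by auto
qed

end
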